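(* For every fixed integer $\ell\ge 1$, there is an algorithm that, given a finite tree $T$, decides in time linear in the size of $T$ whether Maker has a winning strategy in the $K_{1,\ell}$-game on $T$.
   Context: In a Maker-Breaker game on the edge set of a graph $G$, Maker and Breaker alternately claim previously unclaimed edges of $G$, Maker first, until all edges are claimed; Maker wins if she claims all edges of some winning set, and Breaker wins otherwise. In the $K_{1,\ell}$-game, the winning sets are the edge sets of subgraphs isomorphic to the star $K_{1,\ell}$ with $\ell$ edges; i.e. Maker wins if she claims $\ell$ edges incident to a common vertex. *)

theory Defs
  imports Main
begin

section \<open>Finite trees\<close>

text \<open>An undirected graph is a vertex set together with a set of two-element sets of vertices.
  The graphs of the AFP entry on graph theory are directed, and a symmetric digraph
  with an arc is never acyclic there, so its notion of a tree is not usable for undirected graphs.\<close>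

definition simple_graph :: "'a set \<Rightarrow> 'a set set \<Rightarrow> bool" where
  "simple_graph V E \<longleftrightarrow> (\<forall>e\<in>E. \<exists>u\<in>V. \<exists>v\<in>V. u \<noteq> v \<and> e = {u, v})"

definition adjacency :: "'a set set \<Rightarrow> ('a \<times> 'a) set" where
  "adjacency E = {(u, v). {u, v} \<in> E}"

definition connected_graph :: "'a set \<Rightarrow> 'a set set \<Rightarrow> bool" where
  "connected_graph V E \<longleftrightarrow> V \<noteq> {} \<and> (\<forall>u\<in>V. \<forall>v\<in>V. (u, v) \<in> (adjacency E)\<^sup>*)"

definition is_cycle :: "'a set set \<Rightarrow> 'a list \<Rightarrow> bool" where
  "is_cycle E p \<longleftrightarrow> length p \<ge> 3 \<and> distinct p \<and>
     (\<forall>i. Suc i < length p \<longrightarrow> {p ! i, p ! Suc i} \<in> E) \<and> {last p, hd p} \<in> E"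

definition finite_tree :: "'a set \<Rightarrow> 'a set set \<Rightarrow> bool" where
  "finite_tree V E \<longleftrightarrow>
     finite V \<and> simple_graph V E \<and> connected_graph V E \<and> (\<nexists>p. is_cycle E p)"

section \<open>Maker-Breaker games\<close>

text \<open>A complete play on the board \<open>X\<close> is a list enumerating \<open>X\<close> without repetition. Maker moves
  first, so hers are the even positions. A strategy maps each history to a move; it must
  be legal whenever it is Maker's turn and the board is not exhausted, so that no strategy wins
  merely because it admits no play.\<close>

definition maker_strategy :: "'a set \<Rightarrow> ('a list \<Rightarrow> 'a) \<Rightarrow> bool" where
  "maker_strategy X \<sigma> \<longleftrightarrow>
     (\<forall>h. distinct h \<and> set h \<subset> X \<and> even (length h) \<longrightarrow> \<sigma> h \<in> X - set h)"

definition complete_play :: "'a set \<Rightarrow> 'a list \<Rightarrow> bool" where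
  "complete_play X p \<longleftrightarrow> distinct p \<and> set p = X"

definition follows :: "('a list \<Rightarrow> 'a) \<Rightarrow> 'a list \<Rightarrow> bool" where
  "follows \<sigma> p \<longleftrightarrow> (\<forall>i < length p. even i \<longrightarrow> p ! i = \<sigma> (take i p))"

definition maker_claims :: "'a list \<Rightarrow> 'a set" where
  "maker_claims p = {p ! i | i. i < length p \<and> even i}"

definition maker_has_winning_strategy :: "'a set \<Rightarrow> 'a set set \<Rightarrow> bool" where
  "maker_has_winning_strategy X F \<longleftrightarrow>
     (\<exists>\<sigma>. maker_strategy X \<sigma> \<and>
        (\<forall>p. complete_play X p \<and> follows \<sigma> p \<longrightarrow> (\<exists>W\<in>F. W \<subseteq> maker_claims p)))"

text \<open>The edge sets of the subgraphs of \<open>(V, E)\<close> isomorphic to $K_{1,\ell}$, with centre \<open>v\<close>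
  and set of leaves \<open>L\<close>.\<close>

definition star_edge_sets :: "nat \<Rightarrow> 'a set \<Rightarrow> 'a set set \<Rightarrow> 'a set set set" where
  "star_edge_sets l V E =
     {(\<lambda>x. {v, x}) ` L | v L. v \<in> V \<and> L \<subseteq> V - {v} \<and> card L = l \<and> (\<lambda>x. {v, x}) ` L \<subseteq> E}"

definition maker_wins_star_game :: "nat \<Rightarrow> 'a set \<Rightarrow> 'a set set \<Rightarrow> bool" where
  "maker_wins_star_game l V E \<longleftrightarrow> maker_has_winning_strategy E (star_edge_sets l V E)"

section \<open>Random access machines\<close>

text \<open>Unit-cost RAM with registers and an indirectly addressed memory, without
  multiplication. Subtraction is truncated at 0; a program halts when the
  program counter leaves it.\<close>

datatype instr =
    Const nat nat
  | Add nat nat nat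
  | Sub nat nat nat
  | Load nat nat
  | Store nat nat
  | JumpZero nat nat

record config =
  pc :: nat
  reg :: "nat \<Rightarrow> nat"
  mem :: "nat \<Rightarrow> nat"

fun exec :: "instr \<Rightarrow> config \<Rightarrow> config" where
  "exec (Const i k) s = s\<lparr>pc := Suc (pc s), reg := (reg s)(i := k)\<rparr>"
| "exec (Add i j k) s = s\<lparr>pc := Suc (pc s), reg := (reg s)(i := reg s j + reg s k)\<rparr>"
| "exec (Sub i j k) s = s\<lparr>pc := Suc (pc s), reg := (reg s)(i := reg s j - reg s k)\<rparr>"
| "exec (Load i j) s = s\<lparr>pc := Suc (pc s), reg := (reg s)(i := mem s (reg s j))\<rparr>"
| "exec (Store i j) s = s\<lparr>pc := Suc (pc s), mem := (mem s)(reg s i := reg s j)\<rparr>"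
| "exec (JumpZero i a) s = s\<lparr>pc := (if reg s i = 0 then a else Suc (pc s))\<rparr>"

definition halted :: "instr list \<Rightarrow> config \<Rightarrow> bool" where
  "halted P s \<longleftrightarrow> pc s \<ge> length P"

definition step :: "instr list \<Rightarrow> config \<Rightarrow> config" where
  "step P s = (if halted P s then s else exec (P ! pc s) s)"

text \<open>The input word occupies the first memory cells, its length is in register 0, and
  everything else is 0. The answer is read from register 0.\<close>

definition initial_config :: "nat list \<Rightarrow> config" where
  "initial_config x =
     \<lparr>pc = 0, reg = (\<lambda>_. 0)(0 := length x), mem = (\<lambda>i. if i < length x then x ! i else 0)\<rparr>"

definition run :: "instr list \<Rightarrow> nat list \<Rightarrow> nat \<Rightarrow> config" where
  "run P x t = (step P ^^ t) (initial_config x)"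

text \<open>On input \<open>x\<close> the program halts after at most \<open>T\<close> steps with the answer \<open>b\<close>, and no
  register or memory cell ever holds a number above \<open>W\<close>. The bound \<open>W\<close> makes unit cost
  realistic: polynomial \<open>W\<close> means words of logarithmic length, as on a word RAM.\<close>

definition answers_within :: "instr list \<Rightarrow> nat list \<Rightarrow> bool \<Rightarrow> nat \<Rightarrow> nat \<Rightarrow> bool" where
  "answers_within P x b T W \<longleftrightarrow>
     (\<exists>t \<le> T. halted P (run P x t) \<and> reg (run P x t) 0 = (if b then 1 else 0)) \<and>
     (\<forall>t i. reg (run P x t) i \<le> W \<and> mem (run P x t) i \<le> W)"

text \<open>A graph on the vertices \<open>0, \<dots>, n - 1\<close> is presented as \<open>n\<close> followed by the endpoints of its
  edges, each edge listed once, edges and their endpoints in arbitrary order.\<close>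

definition encodes_graph :: "nat list \<Rightarrow> nat set \<Rightarrow> nat set set \<Rightarrow> bool" where
  "encodes_graph x V E \<longleftrightarrow>
     (\<exists>n es. x = n # concat (map (\<lambda>(u, v). [u, v]) es) \<and> V = {..<n} \<and>
        distinct (map (\<lambda>(u, v). {u, v}) es) \<and> E = set (map (\<lambda>(u, v). {u, v}) es))"

end

theory Submission
  imports Defs
begin

text \<open>Root the tree. Let \<open>t v\<close> be the degree of \<open>v\<close> plus the number of its critical children,
  where \<open>w\<close> is critical if \<open>t w \<ge> 2l - 2\<close>. Maker wins iff \<open>t v \<ge> 2l - 1\<close> for some vertex \<open>v\<close>.
  For the if direction, Maker claims the edges above critical vertices, children before parents. Each
  of these moves threatens to win at the child, so Breaker has to answer with another edge of the
  child, leaving the parent's edges alone. When all critical children of \<open>v\<close> have been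
  treated, Maker wins by claiming edges at \<open>v\<close>. Conversely, if \<open>t v \<le> 2l - 2\<close> everywhere, then
  Breaker wins by a pairing strategy, in which the edge above \<open>w\<close> belongs to the group of \<open>w\<close> if
  \<open>w\<close> is critical and to the group of its parent otherwise, and Breaker answers within the group.

  A RAM computes \<open>t\<close> by removing leaves. No adjacency lists are needed: the degree of each vertex and
  the sum of its neighbours are maintained, and for a leaf this sum is its only neighbour. The
  successor of a removed leaf is examined immediately, so one scan over the vertices suffices.\<close>

section \<open>Positions of a Maker-Breaker game\<close>

text \<open>Positions with Maker to move. The last premise of \<open>move\<close> treats the case
  that her move exhausts the board: the premise about Breaker's replies is then vacuous, so a
  winning set has to be demanded directly.\<close>

inductive maker_wins_from :: "'a set \<Rightarrow> 'a set set \<Rightarrow> 'a set \<Rightarrow> 'a set \<Rightarrow> bool"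
  for X :: "'a set" and F :: "'a set set" where
  won: "W \<in> F \<Longrightarrow> W \<subseteq> M \<Longrightarrow> maker_wins_from X F M B"
| move: "e \<in> X - (M \<union> B) \<Longrightarrow>
    (\<And>f. f \<in> X - (insert e M \<union> B) \<Longrightarrow> maker_wins_from X F (insert e M) (insert f B)) \<Longrightarrow>
    (X \<subseteq> insert e M \<union> B \<Longrightarrow> \<exists>W\<in>F. W \<subseteq> insert e M) \<Longrightarrow> maker_wins_from X F M B"

definition winning_move :: "'a set \<Rightarrow> 'a set set \<Rightarrow> 'a set \<Rightarrow> 'a set \<Rightarrow> 'a \<Rightarrow> bool" where
  "winning_move X F M B e \<longleftrightarrow>
     (\<forall>f \<in> X - (insert e M \<union> B). maker_wins_from X F (insert e M) (insert f B)) \<and>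
     (X \<subseteq> insert e M \<union> B \<longrightarrow> (\<exists>W\<in>F. W \<subseteq> insert e M))"

text \<open>A position that is already won offers no distinguished move, but there any free element
  keeps the win.\<close>

lemma winning_move_exists:
  assumes "maker_wins_from X F M B" "\<not> X \<subseteq> M \<union> B"
  shows "\<exists>e \<in> X - (M \<union> B). winning_move X F M B e"
  using assms(1)
proof cases
  case (won W)
  obtain e where "e \<in> X - (M \<union> B)" using assms(2) by blast
  moreover have "winning_move X F M B e"
    unfolding winning_move_def using won by (auto intro: maker_wins_from.won)
  ultimately show ?thesis by blast
next
  case (move e)
  then show ?thesis unfolding winning_move_def by blast
qed

section \<open>From positions to strategies on complete plays\<close>

definition breaker_claims :: "'a list \<Rightarrow> 'a set" where
  "breaker_claims p = {p ! i | i. i < length p \<and> odd i}"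

lemma claims_Nil [simp]: "maker_claims [] = {}" "breaker_claims [] = {}"
  by (auto simp: maker_claims_def breaker_claims_def)

lemma maker_claims_snoc:
  "maker_claims (p @ [e]) = (if even (length p) then insert e (maker_claims p) else maker_claims p)"
proof -
  have "x \<in> maker_claims (p @ [e]) \<longleftrightarrow>
      x \<in> maker_claims p \<or> even (length p) \<and> x = e" for x
    unfolding maker_claims_def mem_Collect_eq length_append_singleton less_Suc_eq nth_append
    by (metis less_irrefl_nat diff_self_eq_0 nth_Cons_0)
  then show ?thesis by auto
qed

lemma breaker_claims_snoc:
  "breaker_claims (p @ [e]) = (if odd (length p) then insert e (breaker_claims p) else breaker_claims p)"
proof -
  have "x \<in> breaker_claims (p @ [e]) \<longleftrightarrow>
      x \<in> breaker_claims p \<or> odd (length p) \<and> x = e" for x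
    unfolding breaker_claims_def mem_Collect_eq length_append_singleton less_Suc_eq nth_append
    by (metis less_irrefl_nat diff_self_eq_0 nth_Cons_0)
  then show ?thesis by auto
qed

lemma claims_Un: "maker_claims p \<union> breaker_claims p = set p"
  unfolding maker_claims_def breaker_claims_def set_conv_nth by blast

lemma claims_disjoint: "distinct p \<Longrightarrow> maker_claims p \<inter> breaker_claims p = {}"
  unfolding maker_claims_def breaker_claims_def by (auto simp: nth_eq_iff_index_eq)

text \<open>The strategy chooses a winning move whenever the current position is winning. In every
  play that follows it, all positions at Maker's turns are then winning, including the last
  one.\<close>

lemma winning_strategy_if_maker_wins_from:
  assumes "maker_wins_from X F {} {}"
  shows "maker_has_winning_strategy X F"
proof -
  \<comment> \<open>Legality is demanded also at histories that are lost or never arise, because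
    \<open>maker_strategy\<close> quantifies over all of them.\<close>
  let ?good = "\<lambda>h e. e \<in> X - set h \<and>
    (maker_wins_from X F (maker_claims h) (breaker_claims h) \<longrightarrow>
     winning_move X F (maker_claims h) (breaker_claims h) e)"
  define \<sigma> where "\<sigma> h = (SOME e. ?good h e)" for h
  have good: "?good h (\<sigma> h)" if "set h \<subset> X" for h
  proof -
    have "\<exists>e. ?good h e"
    proof (cases "maker_wins_from X F (maker_claims h) (breaker_claims h)")
      case True
      have "\<not> X \<subseteq> maker_claims h \<union> breaker_claims h" using that claims_Un[of h] by auto
      from winning_move_exists[OF True this] show ?thesis unfolding claims_Un by blast
    next
      case False then show ?thesis using that by blast
    qed
    then show ?thesis unfolding \<sigma>_def by (rule someI_ex)
  qed
  have "\<exists>W\<in>F. W \<subseteq> maker_claims p" if p: "complete_play X p" "follows \<sigma> p" for p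
  proof -
    have ps: "set p = X" "distinct p" using p by (auto simp: complete_play_def)
    have psub: "set (take k p) \<subset> X" if "k < length p" for k
    proof -
      have "p ! k \<notin> set (take k p)" using ps(2) that
        by (auto simp: in_set_conv_nth nth_eq_iff_index_eq)
      then show ?thesis using ps(1) that set_take_subset[of k p] nth_mem[of k p] by blast
    qed
    have maker_turn: "?good (take (2*k) p) (p ! (2*k))" if "2*k < length p" for k
    proof -
      have "p ! (2*k) = \<sigma> (take (2*k) p)" using p(2) that by (simp add: follows_def)
      then show ?thesis using good[OF psub[OF that]] by simp
    qed
    have inv: "maker_wins_from X F (maker_claims (take (2*k) p)) (breaker_claims (take (2*k) p))"
      if "2*k \<le> length p" for k using that
    proof (induction k)
      case 0 then show ?case using assms by simp
    next
      case (Suc k)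
      let ?h = "take (2*k) p" and ?e = "p ! (2*k)" and ?f = "p ! Suc (2*k)"
      have t: "take (2 * Suc k) p = (?h @ [?e]) @ [?f]"
        using Suc.prems by (simp add: take_Suc_conv_app_nth)
      have "winning_move X F (maker_claims ?h) (breaker_claims ?h) ?e"
        using maker_turn[of k] Suc by simp
      moreover have "?f \<in> X - (insert ?e (maker_claims ?h) \<union> breaker_claims ?h)"
      proof -
        have "?f \<notin> set (take (Suc (2*k)) p)" using ps(2) Suc.prems
          by (auto simp: in_set_conv_nth nth_eq_iff_index_eq)
        moreover have "set (take (Suc (2*k)) p) = insert ?e (maker_claims ?h \<union> breaker_claims ?h)"
          using Suc.prems by (simp add: take_Suc_conv_app_nth claims_Un)
        moreover have "?f \<in> X" using Suc.prems ps(1) by auto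
        ultimately show ?thesis by auto
      qed
      ultimately have "maker_wins_from X F (insert ?e (maker_claims ?h)) (insert ?f (breaker_claims ?h))"
        unfolding winning_move_def by blast
      then show ?case unfolding t maker_claims_snoc breaker_claims_snoc
        using Suc.prems by simp
    qed
    \<comment> \<open>On an even board the final position has no free element, so only rule
      \<open>won\<close> can have produced it. On an odd board Maker moves last, and the exhaustion
      clause of \<open>winning_move\<close> applies.\<close>
    show ?thesis
    proof (cases "even (length p)")
      case True
      then obtain k where k: "length p = 2*k" by blast
      from inv[of k] k have "maker_wins_from X F (maker_claims p) (breaker_claims p)" by simp
      then show ?thesis using claims_Un[of p] ps(1) by cases auto
    next
      case False
      then obtain k where k: "length p = Suc (2*k)" by (metis oddE Suc_eq_plus1)
      let ?h = "take (2*k) p" and ?e = "p ! (2*k)"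
      have t: "p = ?h @ [?e]" using k by (metis lessI take_Suc_conv_app_nth take_all order_refl)
      have m: "maker_claims p = insert ?e (maker_claims ?h)"
        using maker_claims_snoc[of ?h ?e, unfolded t[symmetric]] k by simp
      have b: "breaker_claims p = breaker_claims ?h"
        using breaker_claims_snoc[of ?h ?e, unfolded t[symmetric]] k by simp
      have "winning_move X F (maker_claims ?h) (breaker_claims ?h) ?e"
        using maker_turn[of k] inv[of k] k by simp
      moreover have "X \<subseteq> insert ?e (maker_claims ?h) \<union> breaker_claims ?h"
        using claims_Un[of p] ps(1) m b by auto
      ultimately show ?thesis unfolding winning_move_def m by blast
    qed
  qed
  moreover have "maker_strategy X \<sigma>" unfolding maker_strategy_def using good by blast
  ultimately show ?thesis unfolding maker_has_winning_strategy_def by blast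
qed

text \<open>The fibres of \<open>g\<close> are Breaker's groups. Against any strategy of Maker, one
  consistent play is built in which she gets at most half of each group, rounded up;
  \<open>blocked\<close> says that this is too little for a winning set.\<close>

lemma no_winning_strategy_if_pairing:
  fixes g :: "'a \<Rightarrow> 'b"
  assumes fin: "finite X"
    and blocked: "\<And>M W. M \<subseteq> X \<Longrightarrow> (\<And>c. 2 * card {e\<in>M. g e = c} \<le> Suc (card {e\<in>X. g e = c})) \<Longrightarrow>
                    W \<in> F \<Longrightarrow> \<not> W \<subseteq> M"
  shows "\<not> maker_has_winning_strategy X F"
proof
  assume "maker_has_winning_strategy X F"
  then obtain \<sigma> where \<sigma>: "maker_strategy X \<sigma>"
    and win: "\<And>p. complete_play X p \<Longrightarrow> follows \<sigma> p \<Longrightarrow> \<exists>W\<in>F. W \<subseteq> maker_claims p"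
    unfolding maker_has_winning_strategy_def by blast
  let ?m = "\<lambda>h c. card {e \<in> maker_claims h. g e = c}"
  let ?b = "\<lambda>h c. card {e \<in> breaker_claims h. g e = c}"
  let ?open = "\<lambda>h c. \<exists>e \<in> X - set h. g e = c"
  \<comment> \<open>Breaker answers in the group of Maker's last edge as long as that group has a free edge.\<close>
  let ?J = "\<lambda>h. distinct h \<and> set h \<subseteq> X \<and> follows \<sigma> h \<and>
     (\<forall>c. ?m h c \<le> Suc (?b h c)) \<and> (\<forall>c. ?open h c \<longrightarrow> ?m h c \<le> ?b h c)"
  have finm: "finite (maker_claims h)" and finb: "finite (breaker_claims h)" for h :: "'a list"
    using claims_Un[of h] finite_set[of h] by (metis finite_Un)+
  have follows_snoc: "follows \<sigma> (h @ [e]) \<longleftrightarrow> follows \<sigma> h \<and> (even (length h) \<longrightarrow> e = \<sigma> h)" for h e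
    unfolding follows_def by (auto simp: less_Suc_eq nth_append)
  have "\<exists>p. set p = X \<and> distinct p \<and> follows \<sigma> p \<and> (\<forall>c. ?m p c \<le> Suc (?b p c))"
    if "?J h" "even (length h)" for h
    using that
  proof (induction "card (X - set h)" arbitrary: h rule: less_induct)
    case less
    show ?case
    proof (cases "set h = X")
      case True then show ?thesis using less.prems by blast
    next
      case False
      then have sub: "set h \<subset> X" using less.prems by blast
      define e where "e = \<sigma> h"
      have e: "e \<in> X - set h" using \<sigma> sub less.prems unfolding maker_strategy_def e_def by blast
      let ?h = "h @ [e]"
      have mh: "maker_claims ?h = insert e (maker_claims h)" and bh: "breaker_claims ?h = breaker_claims h"
        using less.prems by (auto simp: maker_claims_snoc breaker_claims_snoc)
      have enm: "e \<notin> maker_claims h" using e claims_Un[of h] by blast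
      have m': "?m ?h c = (if c = g e then Suc (?m h c) else ?m h c)" for c
      proof (cases "c = g e")
        case True
        then have "{x \<in> maker_claims ?h. g x = c} = insert e {x \<in> maker_claims h. g x = c}"
          unfolding mh by auto
        then show ?thesis using True enm finm[of h] by simp
      next
        case False
        then have "{x \<in> maker_claims ?h. g x = c} = {x \<in> maker_claims h. g x = c}" unfolding mh by auto
        then show ?thesis using False by simp
      qed
      have le1: "?m ?h c \<le> Suc (?b ?h c)" for c
      proof (cases "c = g e")
        case True
        then have "?m h c \<le> ?b h c" using less.prems(1) e by blast
        then show ?thesis using True m' bh by simp
      next
        case False then show ?thesis using m' bh less.prems by simp
      qed
      have base: "distinct ?h" "set ?h \<subseteq> X" "follows \<sigma> ?h"
        using less.prems e follows_snoc by (auto simp: e_def)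
      show ?thesis
      proof (cases "set ?h = X")
        case True then show ?thesis using base le1 by blast
      next
        case False
        \<comment> \<open>If Maker has just taken the last edge of a group, the reply is arbitrary.
          This is the only way in which she gets ahead in a group, and her lead there stays at
          one.\<close>
        have "\<exists>f. f \<in> X - set ?h \<and> (?open ?h (g e) \<longrightarrow> g f = g e)" using False base(2) by blast
        then obtain f where f: "f \<in> X - set ?h" "?open ?h (g e) \<Longrightarrow> g f = g e" by blast
        let ?k = "?h @ [f]"
        have mk: "maker_claims ?k = maker_claims ?h" and bk: "breaker_claims ?k = insert f (breaker_claims ?h)"
          using less.prems by (simp_all only: maker_claims_snoc[of ?h] breaker_claims_snoc[of ?h]) simp_all
        have fnb: "f \<notin> breaker_claims ?h" using f claims_Un[of ?h] by blast
        have b': "?b ?k c = (if c = g f then Suc (?b ?h c) else ?b ?h c)" for c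
        proof (cases "c = g f")
          case True
          then have "{x \<in> breaker_claims ?k. g x = c} = insert f {x \<in> breaker_claims ?h. g x = c}"
            unfolding bk by auto
          then show ?thesis using True fnb finb[of ?h] by simp
        next
          case False
          then have "{x \<in> breaker_claims ?k. g x = c} = {x \<in> breaker_claims ?h. g x = c}" unfolding bk by auto
          then show ?thesis using False by simp
        qed
        have m2: "?m ?k c = ?m ?h c" for c using mk by simp
        have le2: "?m ?k c \<le> Suc (?b ?k c)" for c using le1[of c] unfolding m2 b' by auto
        have le3: "?m ?k c \<le> ?b ?k c" if op: "?open ?k c" for c
        proof (cases "c = g e")
          case True
          then have "g f = c" using f(2) op by auto
          then show ?thesis using le1[of c] unfolding m2 b' by simp
        next
          case False
          have "?open h c" using op by auto
          then have "?m h c \<le> ?b h c" using less.prems(1) by blast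
          then show ?thesis unfolding m2 b' m' bh using False by auto
        qed
        have follk: "follows \<sigma> ?k" using base(3) less.prems(2) follows_snoc[of ?h f] by simp
        have "X - set ?k \<subset> X - set h" using e by auto
        then have "card (X - set ?k) < card (X - set h)" by (simp add: fin psubset_card_mono)
        moreover have "?J ?k" using base f(1) follk le2 le3 by fastforce
        ultimately show ?thesis using less.hyps[of ?k] less.prems(2) by simp
      qed
    qed
  qed
  from this[of "[]"] obtain p where p: "set p = X" "distinct p" "follows \<sigma> p"
    "\<And>c. ?m p c \<le> Suc (?b p c)" by (auto simp: follows_def)
  have "2 * ?m p c \<le> Suc (card {e\<in>X. g e = c})" for c
  proof -
    have "{e\<in>X. g e = c} = {e \<in> maker_claims p. g e = c} \<union> {e \<in> breaker_claims p. g e = c}"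
      using claims_Un[of p] p(1) by auto
    moreover have "card \<dots> = ?m p c + ?b p c"
      using claims_disjoint[OF p(2)] finm finb by (intro card_Un_disjoint) auto
    ultimately show ?thesis using p(4)[of c] by simp
  qed
  moreover have "maker_claims p \<subseteq> X" using claims_Un[of p] p(1) by auto
  ultimately show False
    using blocked win[of p] p by (auto simp: complete_play_def)
qed

section \<open>The star game on rooted forests\<close>

definition incident :: "'a set set \<Rightarrow> 'a \<Rightarrow> 'a set set" where
  "incident A v = {e \<in> A. v \<in> e}"

lemma finite_incident [simp]: "finite A \<Longrightarrow> finite (incident A v)"
  by (simp add: incident_def)

lemma incident_mono: "A \<subseteq> A' \<Longrightarrow> incident A v \<subseteq> incident A' v"
  by (auto simp: incident_def)

lemma incident_insert:
  "incident (insert e A) v = (if v \<in> e then insert e (incident A v) else incident A v)"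
  by (auto simp: incident_def)

text \<open>Any \<open>l\<close> edges of \<open>M\<close> at a common vertex form a star, since in
  a simple graph their other ends are distinct. From here on only degrees in \<open>M\<close>
  matter.\<close>

lemma star_subset_iff:
  assumes E: "simple_graph V E" "finite E" and M: "M \<subseteq> E"
  shows "(\<exists>W\<in>star_edge_sets l V E. W \<subseteq> M) \<longleftrightarrow> (\<exists>v\<in>V. l \<le> card (incident M v))"
proof
  assume "\<exists>W\<in>star_edge_sets l V E. W \<subseteq> M"
  then obtain v L where L: "v \<in> V" "L \<subseteq> V - {v}" "card L = l" "(\<lambda>x. {v, x}) ` L \<subseteq> M"
    unfolding star_edge_sets_def by blast
  have "inj_on (\<lambda>x. {v, x}) L" by (rule inj_onI) (auto simp: doubleton_eq_iff)
  then have "l = card ((\<lambda>x. {v, x}) ` L)" using L(3) by (simp add: card_image)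
  also have "\<dots> \<le> card (incident M v)"
    using L(4) finite_subset[OF M E(2)] by (intro card_mono) (auto simp: incident_def)
  finally show "\<exists>v\<in>V. l \<le> card (incident M v)" using L(1) by blast
next
  assume "\<exists>v\<in>V. l \<le> card (incident M v)"
  then obtain v where v: "v \<in> V" "l \<le> card (incident M v)" by blast
  obtain W where W: "W \<subseteq> incident M v" "card W = l"
    using v(2) by (metis obtain_subset_with_card_n)
  define L where "L = {x. {v, x} \<in> W}"
  have each: "\<exists>x\<in>V - {v}. e = {v, x}" if "e \<in> W" for e
  proof -
    have "e \<in> E" "v \<in> e" using that W M by (auto simp: incident_def)
    then show ?thesis using E(1) unfolding simple_graph_def by fastforce
  qed
  have im: "(\<lambda>x. {v, x}) ` L = W" using each unfolding L_def by blast
  have "inj_on (\<lambda>x. {v, x}) L" by (rule inj_onI) (auto simp: doubleton_eq_iff)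
  then have "card L = l" using im W(2) card_image by fastforce
  moreover have "L \<subseteq> V - {v}"
  proof
    fix x assume "x \<in> L"
    then obtain y where "y \<in> V - {v}" "{v, x} = {v, y}" using each unfolding L_def by auto
    then show "x \<in> V - {v}" by (auto simp: doubleton_eq_iff)
  qed
  moreover have WM: "W \<subseteq> M" using W(1) by (auto simp: incident_def)
  ultimately have "W \<in> star_edge_sets l V E"
    unfolding star_edge_sets_def using v(1) im M
    by (intro CollectI exI[of _ v] exI[of _ L]) auto
  then show "\<exists>W\<in>star_edge_sets l V E. W \<subseteq> M" using WM by blast
qed

text \<open>Maker keeps claiming edges at \<open>v\<close> and obtains half of the free ones,
  rounded up. With \<open>m\<close> and \<open>b\<close> edges at \<open>v\<close> already taken by
  Maker and Breaker, she ends with at least \<open>l\<close> if 2l + b \<le> deg + m + 1. A round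
  raises \<open>m\<close> by one and \<open>b\<close> by at most one, so the inequality
  persists.\<close>

lemma maker_wins_at_vertex:
  assumes E: "simple_graph V E" "finite E" and v: "v \<in> V"
    and "M \<union> B \<subseteq> E" "M \<inter> B = {}"
    and "2 * l + card (incident B v) \<le> Suc (card (incident E v) + card (incident M v))"
  shows "maker_wins_from E (star_edge_sets l V E) M B"
  using assms(4-)
proof (induction "card (incident E v - (M \<union> B))" arbitrary: M B rule: less_induct)
  case less
  have fM: "finite M" and fB: "finite B" using less.prems E(2) finite_subset by auto
  \<comment> \<open>Once no edge at \<open>v\<close> is free, deg = a + b with a \<ge> m edges of
    Maker, and the inequality gives 2l \<le> 2a + 1. This serves both ends of the induction: no free
    edge at \<open>v\<close>, and a board exhausted by Maker's move.\<close>
  have full: "\<exists>W\<in>star_edge_sets l V E. W \<subseteq> A"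
    if A: "A \<subseteq> E" "A \<inter> B = {}" "incident E v \<subseteq> A \<union> B" "M \<subseteq> A" for A
  proof -
    have "incident E v = incident A v \<union> incident B v"
      using A less.prems(1) by (auto simp: incident_def)
    moreover have "card \<dots> = card (incident A v) + card (incident B v)"
      using A(1,2) finite_subset[OF A(1) E(2)] fB by (intro card_Un_disjoint) (auto simp: incident_def)
    moreover have "card (incident M v) \<le> card (incident A v)"
      using incident_mono[OF A(4)] finite_subset[OF A(1) E(2)] by (simp add: card_mono)
    ultimately have "l \<le> card (incident A v)" using less.prems(3) by simp
    then show ?thesis using star_subset_iff[OF E A(1)] v by blast
  qed
  show ?case
  proof (cases "incident E v \<subseteq> M \<union> B")
    case True
    then show ?thesis using full[of M] less.prems by (auto intro: maker_wins_from.won)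
  next
    case False
    then obtain e where e: "e \<in> E" "v \<in> e" "e \<notin> M \<union> B" by (auto simp: incident_def)
    show ?thesis
    proof (rule maker_wins_from.move)
      show "e \<in> E - (M \<union> B)" using e by blast
    next
      fix f assume f: "f \<in> E - (insert e M \<union> B)"
      have "incident E v - (insert e M \<union> insert f B) \<subset> incident E v - (M \<union> B)"
        using e by (auto simp: incident_def)
      then have "card (incident E v - (insert e M \<union> insert f B)) < card (incident E v - (M \<union> B))"
        using E(2) by (simp add: psubset_card_mono)
      moreover have "card (incident (insert e M) v) = Suc (card (incident M v))"
        using e fM by (auto simp: incident_insert card_insert_if) (auto simp: incident_def)
      moreover have "card (incident (insert f B) v) \<le> Suc (card (incident B v))"
        by (simp add: incident_insert card_insert_le_m1 fB card_insert_if)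
      ultimately show "maker_wins_from E (star_edge_sets l V E) (insert e M) (insert f B)"
        using less e f by simp
    next
      assume "E \<subseteq> insert e M \<union> B"
      then show "\<exists>W\<in>star_edge_sets l V E. W \<subseteq> insert e M"
        using full[of "insert e M"] e less.prems by (auto simp: incident_def)
    qed
  qed
qed

text \<open>\<open>N\<close> is the set of non-roots.\<close>

locale rooted_forest =
  fixes V N :: "'a set" and par :: "'a \<Rightarrow> 'a" and rank :: "'a \<Rightarrow> nat" and E :: "'a set set"
    and t :: "'a \<Rightarrow> nat" and l :: nat
  assumes l: "l \<ge> 1" and finV: "finite V" and N: "N \<subseteq> V" "par ` N \<subseteq> V"
    and rank: "v \<in> N \<Longrightarrow> rank v < rank (par v)"
    and E: "E = (\<lambda>v. {v, par v}) ` N"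
    and t: "v \<in> V \<Longrightarrow> t v = card (incident E v) + card {w\<in>N. par w = v \<and> 2 * l - 2 \<le> t w}"
begin

abbreviation edge :: "'a \<Rightarrow> 'a set" where "edge v \<equiv> {v, par v}"
abbreviation critical :: "'a \<Rightarrow> bool" where "critical v \<equiv> 2 * l - 2 \<le> t v"
abbreviation crit_children :: "'a \<Rightarrow> 'a set" where "crit_children v \<equiv> {w\<in>N. par w = v \<and> critical w}"

section \<open>Edges of a rooted forest\<close>

lemma finN: "finite N" using finV N(1) finite_subset by blast

lemma finE: "finite E" unfolding E using finN by simp

lemma par_neq: "v \<in> N \<Longrightarrow> par v \<noteq> v" using rank[of v] by auto

lemma edge_eq_iff: "v \<in> N \<Longrightarrow> w \<in> N \<Longrightarrow> edge v = edge w \<longleftrightarrow> v = w"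
  using rank[of v] rank[of w] by (auto simp: doubleton_eq_iff)

lemma inj_edge: "A \<subseteq> N \<Longrightarrow> inj_on edge A"
  by (rule inj_onI) (use edge_eq_iff in blast)

lemma simple: "simple_graph V E"
proof -
  have "\<exists>u\<in>V. \<exists>w\<in>V. u \<noteq> w \<and> edge v = {u, w}" if "v \<in> N" for v
    using that N par_neq[OF that] by (intro bexI[of _ v] bexI[of _ "par v"]) auto
  then show ?thesis unfolding simple_graph_def E by blast
qed

text \<open>\<open>P\<close> collects the treated critical vertices, those whose upper edge Maker
  owns. The condition on \<open>B\<close> says that Breaker has only ever answered her threats, by
  edges from \<open>P\<close> down to non-critical children.\<close>

lemma maker_wins_from_critical:
  assumes "v \<in> V" "2 * l \<le> Suc (t v)"
    and "P \<subseteq> N" "\<And>w. w \<in> P \<Longrightarrow> critical w" "v \<notin> P"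
    and "B \<subseteq> edge ` {y\<in>N. \<not> critical y \<and> par y \<in> P}"
  shows "maker_wins_from E (star_edge_sets l V E) (edge ` P) B"
  using assms(3-)
proof (induction "card (N - P)" arbitrary: P B rule: less_induct)
  case less
  \<comment> \<open>The next vertex has least \<open>rank\<close> among the untreated candidates, so
    all of its critical children have been treated and Maker owns the edges to them.\<close>
  let ?Q = "{w\<in>insert v N. critical w} - P"
  have "v \<in> ?Q" using assms less.prems by auto
  then obtain w where w: "w \<in> ?Q" and min: "\<And>y. y \<in> ?Q \<Longrightarrow> rank w \<le> rank y"
    using ex_has_least_nat[of "\<lambda>w. w \<in> ?Q" v rank] by blast
  have kids: "crit_children w \<subseteq> P"
  proof
    fix y assume y: "y \<in> crit_children w"
    then have "rank y < rank w" using rank by auto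
    then have "y \<notin> ?Q" using min[of y] by auto
    then show "y \<in> P" using y by auto
  qed
  let ?M = "edge ` P"
  have ME: "?M \<subseteq> E" using less.prems(1) unfolding E by auto
  have BE: "B \<subseteq> E" using less.prems(4) unfolding E by auto
  have fM: "finite ?M" and fB: "finite B" using finite_subset[OF ME finE] finite_subset[OF BE finE] by blast+
  have "edge y \<notin> B" if "y \<in> P" for y
  proof
    assume "edge y \<in> B"
    then obtain z where "z \<in> N" "\<not> critical z" "edge y = edge z" using less.prems(4) by blast
    then show False using edge_eq_iff less.prems(1,2) that by blast
  qed
  then have disj: "?M \<inter> B = {}" by blast
  \<comment> \<open>Each edge of Breaker joins a non-critical vertex to a vertex of
    \<open>P\<close>, while \<open>w\<close> is critical and outside \<open>P\<close>.\<close>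
  have incB: "incident B w = {}"
  proof -
    have "w \<notin> edge y" if "y \<in> N" "\<not> critical y" "par y \<in> P" for y using w that by auto
    then show ?thesis using less.prems(4) unfolding incident_def by blast
  qed
  have kidsM: "edge ` crit_children w \<subseteq> incident ?M w" using kids unfolding incident_def by auto
  have "card (edge ` crit_children w) = card (crit_children w)"
    by (rule card_image) (rule inj_edge, auto)
  then have cM: "card (crit_children w) \<le> card (incident ?M w)"
    using card_mono[OF _ kidsM] fM by simp
  have wV: "w \<in> V" using w N(1) assms(1) by blast
  have tw: "t w \<le> card (incident E w) + card (incident ?M w)" using t[OF wV] cM by simp
  show ?case
  proof (cases "2 * l \<le> Suc (t w)")
    case True
    show ?thesis
      using maker_wins_at_vertex[OF simple finE wV, of ?M B l] True tw incB ME BE disj by simp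
  next
    \<comment> \<open>Here \<open>w\<close> differs from \<open>v\<close> and \<open>t w\<close> is
      exactly 2l - 2, one short of a win at \<open>w\<close>. Claiming the edge above
      \<open>w\<close> supplies the missing unit, which is the threat.\<close>
    case False
    have cw: "2 * l \<le> Suc (Suc (t w))" using w by auto
    have wN: "w \<in> N" using w assms(2) False by auto
    have new: "edge w \<in> E - (?M \<union> B)"
    proof -
      have "edge w \<in> E" using wN unfolding E by blast
      moreover have "edge w \<notin> ?M" using w wN less.prems(1) edge_eq_iff by blast
      moreover have "edge w \<notin> B" using incB by (auto simp: incident_def)
      ultimately show ?thesis by blast
    qed
    have M': "edge ` insert w P = insert (edge w) ?M" by simp
    have cM': "card (incident (insert (edge w) ?M) w) = Suc (card (incident ?M w))"
      using new fM by (auto simp: incident_insert card_insert_if) (auto simp: incident_def)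
    show ?thesis
    proof (rule maker_wins_from.move[OF new])
      fix f assume f: "f \<in> E - (insert (edge w) ?M \<union> B)"
      show "maker_wins_from E (star_edge_sets l V E) (insert (edge w) ?M) (insert f B)"
      proof (cases "w \<in> f")
        case False
        then have "incident (insert f B) w = {}" using incB by (simp add: incident_insert)
        then show ?thesis
          using maker_wins_at_vertex[OF simple finE wV, of "insert (edge w) ?M" "insert f B" l]
            tw cw cM' ME BE disj new f by auto
      next
        \<comment> \<open>Maker owns the edge above \<open>w\<close> and those to its critical
          children, so a reply at \<open>w\<close> must go down to a non-critical child and the
          invariant is kept.\<close>
        case True
        obtain y where y: "y \<in> N" "f = edge y" using f unfolding E by blast
        have "y \<noteq> w" using f y by auto
        then have "par y = w" using True y by auto
        moreover have "\<not> critical y"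
        proof
          assume "critical y"
          then have "y \<in> P" using kids y \<open>par y = w\<close> by auto
          then show False using f y by auto
        qed
        ultimately have B': "insert f B \<subseteq> edge ` {y\<in>N. \<not> critical y \<and> par y \<in> insert w P}"
          using y less.prems(4) by auto
        have "N - insert w P \<subset> N - P" using w wN by auto
        then have "card (N - insert w P) < card (N - P)" using finN by (simp add: psubset_card_mono)
        then have "maker_wins_from E (star_edge_sets l V E) (edge ` insert w P) (insert f B)"
          by (rule less.hyps) (use less.prems w wN B' False assms(2) in auto)
        then show ?thesis unfolding M' .
      qed
    next
      assume full: "E \<subseteq> insert (edge w) ?M \<union> B"
      have "incident E w \<subseteq> incident (insert (edge w) ?M) w"
        using full incB by (auto simp: incident_def)
      then have "card (incident E w) \<le> card (incident (insert (edge w) ?M) w)"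
        using fM by (simp add: card_mono)
      then have "l \<le> card (incident (insert (edge w) ?M) w)" using tw cw cM' by simp
      then show "\<exists>W\<in>star_edge_sets l V E. W \<subseteq> insert (edge w) ?M"
        using star_subset_iff[OF simple finE, of "insert (edge w) ?M" l] ME new wV by auto
    qed
  qed
qed

lemma incident_E:
  "incident E v = edge ` ({w\<in>N. par w = v} \<union> ({v} \<inter> N))"
  unfolding E incident_def by auto

text \<open>The groups limit Maker's degree at every vertex: she may take all edges at
  \<open>v\<close> that lie in foreign groups, but only half, rounded up, of the group of
  \<open>v\<close> itself.\<close>

lemma breaker_wins:
  assumes small: "\<And>v. v \<in> V \<Longrightarrow> t v \<le> 2 * l - 2"
  shows "\<not> maker_wins_star_game l V E"
  unfolding maker_wins_star_game_def
proof -
  \<comment> \<open>Breaker pairs the edge above a critical vertex with the edges from this vertex down to its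
    non-critical children.\<close>
  define owner where "owner w = (if critical w then w else par w)" for w
  define g where "g e = owner (the_inv_into N edge e)" for e
  have g: "g (edge w) = owner w" if "w \<in> N" for w
    using the_inv_into_f_f[OF inj_edge[OF subset_refl] that] unfolding g_def by simp
  show "\<not> maker_has_winning_strategy E (star_edge_sets l V E)"
  proof (rule no_winning_strategy_if_pairing[OF finE, where g = g])
    fix M W assume M: "M \<subseteq> E"
      and half: "\<And>c. 2 * card {e\<in>M. g e = c} \<le> Suc (card {e\<in>E. g e = c})"
      and W: "W \<in> star_edge_sets l V E"
    have fM: "finite M" using M finE finite_subset by blast
    have "card (incident M v) < l" if v: "v \<in> V" for v
    proof -
      \<comment> \<open>\<open>C\<close> and \<open>D\<close> stand for the edges down from
        \<open>v\<close>, and \<open>S\<close> or \<open>S'\<close> for the edge above it if there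
        is one. The group of \<open>v\<close> consists of \<open>D\<close> and \<open>S\<close>; the
        edges of \<open>C\<close> and \<open>S'\<close> belong to other groups. Edges of
        \<open>C\<close> count twice in \<open>t v\<close>, which pays for losing them all.\<close>
      define C where "C = crit_children v"
      define D where "D = {w\<in>N. par w = v \<and> \<not> critical w}"
      define S where "S = {v} \<inter> N \<inter> Collect critical"
      define S' where "S' = {v} \<inter> N - Collect critical"
      have sub: "C \<subseteq> N" "D \<subseteq> N" "S \<subseteq> N" "S' \<subseteq> N" by (auto simp: C_def D_def S_def S'_def)
      have fin: "finite C" "finite D" "finite S" "finite S'" using finite_subset[OF _ finN] sub by blast+
      have nv: "v \<notin> C" "v \<notin> D" using par_neq by (auto simp: C_def D_def)
      have disj: "C \<inter> D = {}" "(C \<union> D) \<inter> S = {}" "(C \<union> D \<union> S) \<inter> S' = {}" "D \<inter> S = {}"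
        using nv by (auto simp: C_def D_def S_def S'_def)
      have "incident E v = edge ` (C \<union> D \<union> S \<union> S')"
        unfolding incident_E by (rule arg_cong[where f="image edge"]) (auto simp: C_def D_def S_def S'_def)
      then have "card (incident E v) = card (C \<union> D \<union> S \<union> S')"
        using card_image[OF inj_edge, of "C \<union> D \<union> S \<union> S'"] sub by simp
      also have "\<dots> = card C + card D + card S + card S'"
        using disj fin by (simp add: card_Un_disjoint)
      finally have deg: "t v = 2 * card C + card D + card S + card S'"
        using t[OF v] unfolding C_def by simp
      have "{e\<in>E. g e = v} = edge ` (D \<union> S)"
      proof -
        have "{e\<in>E. g e = v} = edge ` {w\<in>N. owner w = v}"
          using g unfolding E by force
        also have "{w\<in>N. owner w = v} = D \<union> S" by (auto simp: D_def S_def owner_def)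
        finally show ?thesis .
      qed
      then have "card {e\<in>E. g e = v} = card D + card S"
        using card_image[OF inj_edge, of "D \<union> S"] sub disj fin by (simp add: card_Un_disjoint)
      then have G: "2 * card {e\<in>M. g e = v} \<le> Suc (card D + card S)" using half[of v] by simp
      have "incident M v \<subseteq> edge ` C \<union> edge ` S' \<union> {e\<in>M. g e = v}"
      proof
        fix e assume e: "e \<in> incident M v"
        then obtain w where w: "w \<in> N" "e = edge w" "w = v \<or> par w = v"
          using M unfolding E incident_def by auto
        then have "w \<in> C \<or> w \<in> S' \<or> owner w = v" by (auto simp: C_def S'_def owner_def)
        then show "e \<in> edge ` C \<union> edge ` S' \<union> {e\<in>M. g e = v}"
          using w e g[OF w(1)] by (auto simp: incident_def simp del: insert_iff)
      qed
      then have "card (incident M v) \<le> card (edge ` C \<union> edge ` S' \<union> {e\<in>M. g e = v})"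
        using fin fM by (intro card_mono) auto
      also have "\<dots> \<le> card (edge ` C) + card (edge ` S') + card {e\<in>M. g e = v}"
        by (meson add_le_mono card_Un_le order_refl order_trans)
      also have "\<dots> \<le> card C + card S' + card {e\<in>M. g e = v}"
        using card_image_le fin by (intro add_mono) auto
      finally have le: "card (incident M v) \<le> card C + card S' + card {e\<in>M. g e = v}" .
      have tv: "t v \<le> 2 * l - 2" by (rule small[OF v])
      \<comment> \<open>The edge of \<open>S'\<close> counts only once in \<open>t v\<close>
        although Maker may get it for sure. It exists only if \<open>v\<close> is non-critical, and
        then t v \<le> 2l - 3 makes up for the difference.\<close>
      show ?thesis
      proof (cases "v \<in> N \<and> \<not> critical v")
        case True
        then have "S' = {v}" "S = {}" by (auto simp: S'_def S_def)
        then show ?thesis using le deg G True l by (cases "t v") auto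
      next
        case False
        then have "S' = {}" by (auto simp: S'_def)
        then show ?thesis using le deg G tv l by simp
      qed
    qed
    then show "\<not> W \<subseteq> M" using star_subset_iff[OF simple finE M, of l] W by (meson not_le)
  qed
qed

theorem maker_wins_star_game_iff:
  "maker_wins_star_game l V E \<longleftrightarrow> (\<exists>v\<in>V. 2 * l - 1 \<le> t v)"
proof
  assume "maker_wins_star_game l V E"
  then show "\<exists>v\<in>V. 2 * l - 1 \<le> t v" using breaker_wins by fastforce
next
  assume "\<exists>v\<in>V. 2 * l - 1 \<le> t v"
  then obtain v where "v \<in> V" "2 * l \<le> Suc (t v)" by auto
  from maker_wins_from_critical[OF this, of "{}" "{}"]
  show "maker_wins_star_game l V E"
    unfolding maker_wins_star_game_def by (intro winning_strategy_if_maker_wins_from) simp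
qed

end

section \<open>Peeling leaves\<close>

lemma is_cycle_mono: "is_cycle F p \<Longrightarrow> F \<subseteq> E \<Longrightarrow> is_cycle E p"
  unfolding is_cycle_def by blast

definition neighbours :: "'a set set \<Rightarrow> 'a \<Rightarrow> 'a set" where
  "neighbours A v = {u. {v, u} \<in> A}"

lemma neighbours_commute: "u \<in> neighbours A v \<longleftrightarrow> v \<in> neighbours A u"
  by (simp add: neighbours_def insert_commute)

lemma neighbours_subset:
  assumes "simple_graph V A" shows "neighbours A v \<subseteq> V - {v}"
proof
  fix u assume "u \<in> neighbours A v"
  then obtain a b where "a \<in> V" "b \<in> V" "a \<noteq> b" "{v, u} = {a, b}"
    using assms unfolding simple_graph_def neighbours_def by blast
  then show "u \<in> V - {v}" by (auto simp: doubleton_eq_iff)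
qed

lemma simple_graph_subset: "simple_graph V E \<Longrightarrow> F \<subseteq> E \<Longrightarrow> simple_graph V F"
  unfolding simple_graph_def by blast

lemma incident_eq_neighbours:
  assumes "simple_graph V A" shows "incident A v = (\<lambda>u. {v, u}) ` neighbours A v"
proof
  show "incident A v \<subseteq> (\<lambda>u. {v, u}) ` neighbours A v"
  proof
    fix e assume e: "e \<in> incident A v"
    then obtain a b where "e = {a, b}" using assms unfolding simple_graph_def incident_def by blast
    moreover have "v \<in> e" "e \<in> A" using e by (auto simp: incident_def)
    ultimately show "e \<in> (\<lambda>u. {v, u}) ` neighbours A v"
      unfolding neighbours_def by (auto simp: insert_commute)
  qed
qed (auto simp: neighbours_def incident_def)

lemma card_incident:
  assumes "simple_graph V A" shows "card (incident A v) = card (neighbours A v)"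
  unfolding incident_eq_neighbours[OF assms]
  by (rule card_image) (rule inj_onI, auto simp: doubleton_eq_iff)

text \<open>The end \<open>v\<close> of a longest path is a leaf: a second neighbour would prolong
  the path if it is off the path and close a cycle if it is on it.\<close>

lemma leaf_exists:
  assumes V: "finite V" and F: "simple_graph V F" "F \<noteq> {}" and acyc: "\<nexists>p. is_cycle F p"
  shows "\<exists>v p. neighbours F v = {p}"
proof -
  define path where "path q \<longleftrightarrow> distinct q \<and> set q \<subseteq> V \<and> 2 \<le> length q \<and>
     (\<forall>i. Suc i < length q \<longrightarrow> {q ! i, q ! Suc i} \<in> F)" for q
  obtain a b where ab: "a \<in> V" "b \<in> V" "a \<noteq> b" "{a, b} \<in> F"
    using F unfolding simple_graph_def by fastforce
  then have "path [a, b]" unfolding path_def by auto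
  moreover have "length q < Suc (card V)" if "path q" for q
    using that V card_mono[of V "set q"] distinct_card[of q] unfolding path_def by auto
  ultimately obtain q where q: "path q" and maxq: "\<And>r. path r \<Longrightarrow> length r \<le> length q"
    using ex_has_greatest_nat[of path "[a, b]" length "Suc (card V)"] by blast
  obtain v p r where vpr: "q = v # p # r" using q unfolding path_def
    by (metis Suc_le_length_iff numeral_2_eq_2)
  have p: "{v, p} \<in> F" using q vpr unfolding path_def by (metis length_Cons nth_Cons_0 nth_Cons_Suc zero_less_Suc Suc_less_eq)
  have "u = p" if u: "{v, u} \<in> F" for u
  proof (rule ccontr)
    assume "u \<noteq> p"
    have uV: "u \<in> V - {v}" using neighbours_subset[OF F(1), of v] u by (auto simp: neighbours_def)
    show False
    proof (cases "u \<in> set q")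
      case False
      have "{(u # q) ! i, (u # q) ! Suc i} \<in> F" if "Suc i < length (u # q)" for i
        using that q u vpr unfolding path_def by (cases i) (auto simp: insert_commute)
      then have "path (u # q)" using q False uV unfolding path_def by auto
      then show False using maxq[of "u # q"] by simp
    next
      case True
      then obtain j where j: "j < length q" "q ! j = u" by (auto simp: in_set_conv_nth)
      have "j \<noteq> 0" using j uV vpr by (intro notI) auto
      moreover have "j \<noteq> 1" using j \<open>u \<noteq> p\<close> vpr by (intro notI) auto
      \<comment> \<open>As \<open>u\<close> is neither of the first two vertices of the path, the
        prefix up to \<open>u\<close> has the three vertices that a cycle needs.\<close>
      ultimately have j2: "j \<ge> 2" by simp
      let ?c = "take (Suc j) q"
      have "last ?c = u" using j by (simp add: take_Suc_conv_app_nth)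
      moreover have "hd ?c = v" using vpr by simp
      ultimately have "is_cycle F ?c"
        using q j j2 u unfolding is_cycle_def path_def by (auto simp: insert_commute)
      then show False using acyc by blast
    qed
  qed
  then have "neighbours F v = {p}" using p unfolding neighbours_def by blast
  then show ?thesis by blast
qed

text \<open>Induction by deleting a leaf together with its edge. This makes the input length, and
  with it the running time, linear in the number of vertices.\<close>

lemma card_edges_less_card_vertices:
  assumes "finite V" "V \<noteq> {}" "simple_graph V F" "\<nexists>p. is_cycle F p"
  shows "card F < card V"
  using assms
proof (induction "card V" arbitrary: V F)
  case 0 then show ?case by simp
next
  case (Suc k)
  show ?case
  proof (cases "F = {}")
    case True then show ?thesis using Suc.prems by (simp add: card_gt_0_iff)
  next
    case False
    obtain v p where vp: "neighbours F v = {p}" using leaf_exists Suc.prems False by metis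
    then have e: "{v, p} \<in> F" by (auto simp: neighbours_def)
    have v: "v \<in> V" and p: "p \<in> V - {v}"
      using neighbours_subset[OF Suc.prems(3)] vp neighbours_commute[of p F v] by blast+
    let ?F = "F - {{v, p}}"
    have "\<exists>x\<in>V - {v}. \<exists>y\<in>V - {v}. x \<noteq> y \<and> e = {x, y}" if "e \<in> ?F" for e
    proof -
      have "v \<notin> e"
      proof
        assume "v \<in> e"
        then have "e \<in> incident F v" using that by (simp add: incident_def)
        then show False using that vp incident_eq_neighbours[OF Suc.prems(3), of v] by simp
      qed
      moreover obtain x y where "x \<in> V" "y \<in> V" "x \<noteq> y" "e = {x, y}"
        using Suc.prems(3) \<open>e \<in> ?F\<close> unfolding simple_graph_def by blast
      ultimately show ?thesis by auto
    qed
    then have s: "simple_graph (V - {v}) ?F" unfolding simple_graph_def by blast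
    have "card ?F < card (V - {v})"
    proof (rule Suc.hyps(1))
      show "k = card (V - {v})" using Suc.hyps(2) v by simp
      show "\<nexists>q. is_cycle ?F q" using Suc.prems(4) is_cycle_mono[of ?F _ F] by blast
    qed (use Suc.prems p s in auto)
    moreover have "F \<subseteq> Pow V" using Suc.prems(3) unfolding simple_graph_def by auto
    then have "finite F" using Suc.prems(1) finite_subset by (metis finite_Pow_iff)
    ultimately show ?thesis using e v Suc.prems(1) by (simp add: card_Diff_singleton card_gt_0_iff)
  qed
qed

text \<open>\<open>N\<close> is the set of peeled vertices and \<open>F\<close> the set of remaining edges.\<close>

locale peeling =
  fixes l n :: nat and E :: "nat set set" and N :: "nat set" and par rank :: "nat \<Rightarrow> nat"
    and F :: "nat set set" and T D S :: "nat \<Rightarrow> nat"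
  assumes simple: "simple_graph {..<n} E"
    and N: "N \<subseteq> {..<n}" "par ` N \<subseteq> {..<n}"
    and E: "E = (\<lambda>v. {v, par v}) ` N \<union> F"
    and F: "\<And>e. e \<in> F \<Longrightarrow> e \<inter> N = {}"
    and rank_out: "\<And>v. v \<notin> N \<Longrightarrow> rank v = card N"
    and rank_in: "\<And>v. v \<in> N \<Longrightarrow> rank v < card N \<and> rank v < rank (par v)"
    and T: "\<And>v. v < n \<Longrightarrow>
      T v = card (neighbours E v) + card {w\<in>N. par w = v \<and> 2 * l - 2 \<le> T w}"
    and D: "\<And>v. v < n \<Longrightarrow> D v = card (neighbours F v)"
    and S: "\<And>v. v < n \<Longrightarrow> D v \<noteq> 0 \<Longrightarrow> S v = \<Sum>(neighbours F v)"
begin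

lemma simpleF: "simple_graph {..<n} F"
  using simple_graph_subset[OF simple] E by blast

lemma finF: "finite F"
proof -
  have "F \<subseteq> Pow {..<n}" using simpleF unfolding simple_graph_def by auto
  then show ?thesis by (rule finite_subset) simp
qed

lemma fin_neighbours: "finite (neighbours F v)"
  using neighbours_subset[OF simpleF] finite_subset by blast

lemma T_le: "v < n \<Longrightarrow> T v \<le> 2 * n"
proof -
  assume "v < n"
  have "card (neighbours E v) \<le> card {..<n}"
    using neighbours_subset[OF simple, of v] by (intro card_mono) auto
  moreover have "card {w\<in>N. par w = v \<and> 2 * l - 2 \<le> T w} \<le> card {..<n}"
    using N by (intro card_mono) auto
  ultimately show ?thesis using T[OF \<open>v < n\<close>] by simp
qed

text \<open>The sum of a single neighbour is that neighbour. The last claim makes the sum stored at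
  the parent meaningful, so that \<open>v\<close> can be subtracted from it.\<close>

lemma leaf:
  assumes v: "v < n" "D v = 1"
  shows "neighbours F v = {S v}" "S v < n" "S v \<noteq> v" "{v, S v} \<in> F" "v \<notin> N" "S v \<notin> N" "D (S v) \<noteq> 0"
proof -
  obtain p where p: "neighbours F v = {p}" using v D[of v] card_1_singletonE by metis
  then have "S v = p" using S[of v] v by simp
  with p show nb: "neighbours F v = {S v}" by simp
  then show lt: "S v < n" and "S v \<noteq> v" using neighbours_subset[OF simpleF, of v] by auto
  show e: "{v, S v} \<in> F" using nb by (auto simp: neighbours_def)
  then show "v \<notin> N" "S v \<notin> N" using F[OF e] by auto
  have "v \<in> neighbours F (S v)" using nb neighbours_commute[of v F "S v"] by simp
  then show "D (S v) \<noteq> 0" using D[OF lt] fin_neighbours by auto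
qed

text \<open>The only neighbour \<open>p\<close> of the leaf becomes its parent and their edge leaves
  \<open>F\<close>. Ranks record the order of removal, and all unpeeled vertices share the next
  rank, hence ranks grow towards parents. The sum of \<open>v\<close> is left stale, which is
  harmless since its degree is now 0.\<close>

lemma peel:
  assumes v: "v < n" "D v = 1"
  defines "p \<equiv> S v"
  shows "peeling l n E (insert v N) (par(v := p))
    (\<lambda>x. if x \<in> N then rank x else if x = v then card N else Suc (card N)) (F - {{v, p}})
    (if 2 * l - 2 \<le> T v then T(p := Suc (T p)) else T) (D(v := 0, p := D p - 1)) (S(p := S p - v))"
    (is "peeling l n E ?N ?par ?rank ?F ?T ?D ?S")
proof -
  note lf = leaf[OF v, folded p_def]
  have finN: "finite N" using N(1) finite_subset by blast
  have parN: "?par w = par w" if "w \<in> N" for w using that lf by auto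
  \<comment> \<open>Only the value of \<open>p\<close> can change, and \<open>p\<close> is not
    peeled yet. The value of a peeled vertex is therefore final, so criticality may be decided at
    the moment of removal.\<close>
  have TN: "?T w = T w" if "w \<in> insert v N" for w using that lf by auto
  have nbF: "neighbours ?F x = (if x = v then neighbours F v - {p}
      else if x = p then neighbours F p - {v} else neighbours F x)" for x
    using lf by (auto simp: neighbours_def doubleton_eq_iff)
  have vp: "v \<in> neighbours F p" using lf(1) neighbours_commute[of v F p] by simp
  have Dp: "?D x = card (neighbours ?F x)" if "x < n" for x
    using that lf D vp by (auto simp: nbF)
  show ?thesis
  proof
    show "simple_graph {..<n} E" by (rule simple)
    show "?N \<subseteq> {..<n}" "?par ` ?N \<subseteq> {..<n}" using N v lf parN by auto
    have "(\<lambda>x. {x, ?par x}) ` N = (\<lambda>x. {x, par x}) ` N" 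
      by (rule image_cong[OF refl]) (simp only: parN)
    then have "(\<lambda>x. {x, ?par x}) ` ?N = insert {v, p} ((\<lambda>x. {x, par x}) ` N)"
      by (simp only: image_insert fun_upd_same)
    then have "(\<lambda>x. {x, ?par x}) ` ?N \<union> ?F = (\<lambda>x. {x, par x}) ` N \<union> F"
      using lf(4) by auto
    then show "E = (\<lambda>x. {x, ?par x}) ` ?N \<union> ?F" by (rule trans[OF E sym])
    show "e \<inter> ?N = {}" if e: "e \<in> ?F" for e
    proof -
      have "v \<notin> e"
      proof
        assume "v \<in> e"
        then have "e \<in> incident F v" using e by (simp add: incident_def)
        then show False using e lf incident_eq_neighbours[OF simpleF, of v] by simp
      qed
      then show ?thesis using F e by auto
    qed
    show "?rank x = card ?N" if "x \<notin> ?N" for x using that lf finN by auto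
    show "?rank x < card ?N \<and> ?rank x < ?rank (?par x)" if "x \<in> ?N" for x
    proof (cases "x = v")
      case True then show ?thesis using lf finN by auto
    next
      case False
      then have x: "x \<in> N" using that by simp
      have "rank x < card N" "rank x < rank (par x)" using rank_in[OF x] by auto
      then show ?thesis using x False lf finN rank_out by auto
    qed
    show "?T x = card (neighbours E x) + card {w\<in>?N. ?par w = x \<and> 2 * l - 2 \<le> ?T w}" if x: "x < n" for x
    proof -
      let ?C = "{w\<in>N. par w = x \<and> 2 * l - 2 \<le> T w}"
      have "{w\<in>?N. ?par w = x \<and> 2 * l - 2 \<le> ?T w} = ?C \<union> (if x = p \<and> 2 * l - 2 \<le> T v then {v} else {})"
        using TN parN lf by auto
      moreover have "v \<notin> ?C" "finite ?C" using lf finN by auto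
      then have "card (?C \<union> (if b then {v} else {})) = card ?C + (if b then 1 else 0)" for b
        by (cases b) (simp_all del: mem_Collect_eq)
      ultimately have "card {w\<in>?N. ?par w = x \<and> 2 * l - 2 \<le> ?T w} =
          card ?C + (if x = p \<and> 2 * l - 2 \<le> T v then 1 else 0)"
        by (simp only:)
      then show ?thesis using T[OF x] by auto
    qed
    show "?D x = card (neighbours ?F x)" if "x < n" for x by (rule Dp[OF that])
    show "?S x = \<Sum>(neighbours ?F x)" if x: "x < n" "?D x \<noteq> 0" for x
    proof (cases "x = p")
      case True
      then have "S p = \<Sum>(neighbours F p)" using S lf by auto
      also have "\<dots> = v + \<Sum>(neighbours F p - {v})"
        using sum.remove[OF fin_neighbours vp, of "\<lambda>x. x"] by simp
      finally show ?thesis using True lf by (simp add: nbF)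
    next
      case False
      then have "x \<noteq> v" using x by auto
      then show ?thesis using False S x by (simp add: nbF)
    qed
  qed
qed

text \<open>An acyclic graph without leaves has no edges, so when peeling is stuck the parent edges
  are all of \<open>E\<close> and form a rooted forest.\<close>

lemma maker_wins_iff:
  assumes l: "l \<ge> 1" and acyc: "\<nexists>p. is_cycle E p" and stuck: "\<And>v. v < n \<Longrightarrow> D v \<noteq> 1"
  shows "maker_wins_star_game l {..<n} E \<longleftrightarrow> (\<exists>v<n. 2 * l - 1 \<le> T v)"
proof -
  have "F = {}"
  proof (rule ccontr)
    assume "F \<noteq> {}"
    moreover have "\<nexists>p. is_cycle F p" using acyc is_cycle_mono E by blast
    ultimately obtain v p where vp: "neighbours F v = {p}"
      using leaf_exists simpleF by (metis finite_lessThan)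
    then have "v \<in> neighbours F p" using neighbours_commute[of v F p] by simp
    then have "v < n" using neighbours_subset[OF simpleF, of p] by blast
    then show False using stuck[of v] D[of v] vp by simp
  qed
  \<comment> \<open>The locale asks for \<open>t\<close> only as a solution of its recursion, so the
    computed \<open>T\<close> can be used as it stands.\<close>
  interpret rooted_forest "{..<n}" N par rank E T l
  proof
    show "E = (\<lambda>v. {v, par v}) ` N" using E \<open>F = {}\<close> by simp
    show "T v = card (incident E v) + card {w \<in> N. par w = v \<and> 2 * l - 2 \<le> T w}"
      if "v \<in> {..<n}" for v using T[of v] that card_incident[OF simple] by simp
  qed (use l N rank_in in auto)
  show ?thesis using maker_wins_star_game_iff by auto
qed

end

lemma peeling_start:
  assumes "simple_graph {..<n} E"
  shows "peeling l n E {} id (\<lambda>_. 0) E (\<lambda>v. card (neighbours E v)) (\<lambda>v. card (neighbours E v))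
    (\<lambda>v. \<Sum>(neighbours E v))"
  using assms by unfold_locales auto

section \<open>Bounded executions\<close>

definition bounded :: "nat \<Rightarrow> config \<Rightarrow> bool" where
  "bounded W s \<longleftrightarrow> (\<forall>i. reg s i \<le> W \<and> mem s i \<le> W)"

text \<open>A timed Hoare triple for one start state that also bounds all words on the way.
  Boundedness of the start is a premise inside the definition, so that segments chain without
  proving it again.\<close>

definition leads :: "instr list \<Rightarrow> nat \<Rightarrow> nat \<Rightarrow> config \<Rightarrow> (config \<Rightarrow> bool) \<Rightarrow> bool" where
  "leads P W k s Q \<longleftrightarrow> (bounded W s \<longrightarrow>
     (\<exists>j\<le>k. (\<forall>i\<le>j. bounded W ((step P ^^ i) s)) \<and> Q ((step P ^^ j) s)))"

lemma leads_refl: "Q s \<Longrightarrow> leads P W k s Q"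
  unfolding leads_def by (intro impI exI[of _ 0]) auto

lemma leads_trans:
  assumes s: "leads P W k s Q" and Q: "\<And>s'. Q s' \<Longrightarrow> leads P W k' s' Q'"
  shows "leads P W (k + k') s Q'"
  unfolding leads_def
proof
  assume b: "bounded W s"
  then obtain j where j: "j \<le> k" "\<And>i. i \<le> j \<Longrightarrow> bounded W ((step P ^^ i) s)" "Q ((step P ^^ j) s)"
    using s unfolding leads_def by blast
  then obtain j' where j': "j' \<le> k'" "\<And>i. i \<le> j' \<Longrightarrow> bounded W ((step P ^^ i) ((step P ^^ j) s))"
     "Q' ((step P ^^ j') ((step P ^^ j) s))"
    using Q[OF j(3)] unfolding leads_def by blast
  have add: "(step P ^^ i) ((step P ^^ j) s) = (step P ^^ (i + j)) s" for i
    by (simp add: funpow_add)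
  have "bounded W ((step P ^^ i) s)" if "i \<le> j' + j" for i
  proof (cases "i \<le> j")
    case False
    then show ?thesis using j'(2)[of "i - j"] that unfolding add by simp
  qed (rule j(2))
  then show "\<exists>j\<le>k + k'. (\<forall>i\<le>j. bounded W ((step P ^^ i) s)) \<and> Q' ((step P ^^ j) s)"
    using j j' unfolding add by (intro exI[of _ "j' + j"]) auto
qed

lemma leads_mono: "leads P W k s Q \<Longrightarrow> k \<le> k' \<Longrightarrow> leads P W k' s Q"
  unfolding leads_def by (meson order_trans)

text \<open>Only constants and additions can produce a number above the bound.\<close>

fun within :: "nat \<Rightarrow> instr \<Rightarrow> (nat \<Rightarrow> nat) \<Rightarrow> bool" where
  "within W (Const i k) R = (k \<le> W)"
| "within W (Add i j k) R = (R j + R k \<le> W)"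
| "within W _ R = True"

lemma leads_step:
  assumes "pc s < length P" "0 < k" "within W (P ! pc s) (reg s)"
    and cont: "leads P W (k - 1) (exec (P ! pc s) s) Q"
  shows "leads P W k s Q"
proof -
  have s: "step P s = exec (P ! pc s) s" using assms(1) by (simp add: step_def halted_def)
  have "bounded W (step P s)" if "bounded W s"
    using assms(3) that unfolding s bounded_def
    by (cases "P ! pc s") (auto intro: le_trans[OF diff_le_self])
  then have "leads P W 1 s (\<lambda>s'. s' = step P s)"
    unfolding leads_def by (intro impI exI[of _ 1]) (auto simp: le_Suc_eq)
  from leads_trans[OF this, of "k - 1" Q] show ?thesis using cont s assms(2) by simp
qed

text \<open>A halted configuration never changes, so the word bound up to halting extends to all
  times.\<close>

lemma answers_withinI:
  assumes "leads P W T (initial_config x) (\<lambda>s. halted P s \<and> reg s 0 = (if b then 1 else 0))"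
    and "bounded W (initial_config x)"
  shows "answers_within P x b T W"
proof -
  obtain j where j: "j \<le> T" "\<And>i. i \<le> j \<Longrightarrow> bounded W (run P x i)" "halted P (run P x j)"
     "reg (run P x j) 0 = (if b then 1 else 0)"
    using assms unfolding leads_def run_def by blast
  have "run P x (i + j) = run P x j" for i
    by (induction i) (use j(3) in \<open>auto simp: run_def step_def\<close>)
  then have "bounded W (run P x t)" for t
    using j(2) by (metis le_add_diff_inverse2 nat_le_linear)
  then show ?thesis using j unfolding answers_within_def bounded_def by blast
qed

section \<open>The program\<close>

text \<open>With \<open>L\<close> the length of the input, the cells \<open>L + v\<close>, \<open>L + n + v\<close> and \<open>L + 2n + v\<close> hold
  \<open>T v\<close>, \<open>D v\<close> and \<open>S v\<close>. Register 9 is always 0, hence a jump testing it is unconditional.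
  The numbers in the comments are the addresses of jump targets.\<close>

definition program :: "nat \<Rightarrow> instr list" where
  "program l = [
    Const 1 1,
    Load 2 9,
    Add 3 0 9,
    Add 4 3 2,
    Add 5 4 2,
    Const 6 1,
    \<comment> \<open>6: read the next edge\<close>
    Sub 7 0 6,
    JumpZero 7 37,
    Load 10 6,
    Add 6 6 1,
    Load 11 6,
    Add 6 6 1,
    Add 12 3 10,
    Load 13 12,
    Add 13 13 1,
    Store 12 13,
    Add 12 4 10,
    Load 13 12,
    Add 13 13 1,
    Store 12 13,
    Add 12 5 10,
    Load 13 12,
    Add 13 13 11,
    Store 12 13,
    Add 12 3 11,
    Load 13 12,
    Add 13 13 1,
    Store 12 13,
    Add 12 4 11,
    Load 13 12,
    Add 13 13 1,
    Store 12 13,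
    Add 12 5 11,
    Load 13 12,
    Add 13 13 10,
    Store 12 13,
    JumpZero 9 6,
    \<comment> \<open>37\<close>
    Const 8 (2 * l - 2),
    Const 6 0,
    Const 10 0,
    \<comment> \<open>40: is the current vertex, in register 10, a leaf?\<close>
    Add 12 4 10,
    Load 13 12,
    JumpZero 13 45,
    Sub 13 13 1,
    JumpZero 13 50,
    \<comment> \<open>45: no, advance the scan\<close>
    Add 6 6 1,
    Add 10 6 9,
    Sub 13 2 6,
    JumpZero 13 72,
    JumpZero 9 40,
    \<comment> \<open>50: yes, peel it and continue with its parent\<close>
    Store 12 13,
    Add 12 5 10,
    Load 11 12,
    Add 12 4 11,
    Load 13 12,
    Sub 13 13 1,
    Store 12 13,
    Add 12 5 11,
    Load 13 12,
    Sub 13 13 10,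
    Store 12 13,
    Add 12 3 10,
    Load 13 12,
    Sub 13 8 13,
    JumpZero 13 66,
    JumpZero 9 70,
    \<comment> \<open>66: the leaf is critical\<close>
    Add 12 3 11,
    Load 13 12,
    Add 13 13 1,
    Store 12 13,
    \<comment> \<open>70\<close>
    Add 10 11 9,
    JumpZero 9 40,
    \<comment> \<open>72\<close>
    Const 8 (2 * l - 1),
    Const 6 0,
    Const 0 0,
    \<comment> \<open>75: search for a vertex at which Maker wins\<close>
    Sub 13 2 6,
    JumpZero 13 85,
    Add 12 3 6,
    Load 13 12,
    Add 6 6 1,
    Sub 13 8 13,
    JumpZero 13 83,
    JumpZero 9 75,
    \<comment> \<open>83\<close>
    Const 0 1,
    JumpZero 9 75]"

lemma length_program: "length (program l) = 85"
  by (simp add: program_def)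

text \<open>Memory is described by the three tables, so that a store becomes an update of one of
  them and symbolic execution never leaves this form.\<close>

definition layout ::
  "nat \<Rightarrow> nat list \<Rightarrow> (nat \<Rightarrow> nat) \<Rightarrow> (nat \<Rightarrow> nat) \<Rightarrow> (nat \<Rightarrow> nat) \<Rightarrow> nat \<Rightarrow> nat" where
  "layout n x T D S a =
     (if a < length x then x ! a
      else if a < length x + n then T (a - length x)
      else if a < length x + n + n then D (a - (length x + n))
      else if a < length x + n + n + n then S (a - (length x + n + n))
      else 0)"

lemma layout_read [simp]:
  "a < length x \<Longrightarrow> layout n x T D S a = x ! a"
  "v < n \<Longrightarrow> layout n x T D S (length x + v) = T v"
  "v < n \<Longrightarrow> layout n x T D S (length x + n + v) = D v"
  "v < n \<Longrightarrow> layout n x T D S (length x + n + n + v) = S v"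
  by (simp_all add: layout_def)

lemma layout_write [simp]:
  assumes "v < n"
  shows "(layout n x T D S)(length x + v := y) = layout n x (T(v := y)) D S"
    and "(layout n x T D S)(length x + n + v := y) = layout n x T (D(v := y)) S"
    and "(layout n x T D S)(length x + n + n + v := y) = layout n x T D (S(v := y))"
proof -
  let ?M = "layout n x T D S"
  have "(?M(length x + v := y)) a = layout n x (T(v := y)) D S a" for a
  proof (cases "a = length x + v")
    case False
    then have "\<not> a < length x \<Longrightarrow> a - length x \<noteq> v" by arith
    then show ?thesis using False by (simp add: layout_def)
  qed (use assms in \<open>simp add: layout_def\<close>)
  then show "?M(length x + v := y) = layout n x (T(v := y)) D S" by blast
  have "(?M(length x + n + v := y)) a = layout n x T (D(v := y)) S a" for a
  proof (cases "a = length x + n + v")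
    case False
    then have "\<not> a < length x + n \<Longrightarrow> a - (length x + n) \<noteq> v" by arith
    then show ?thesis using False by (simp add: layout_def)
  qed (use assms in \<open>simp add: layout_def\<close>)
  then show "?M(length x + n + v := y) = layout n x T (D(v := y)) S" by blast
  have "(?M(length x + n + n + v := y)) a = layout n x T D (S(v := y)) a" for a
  proof (cases "a = length x + n + n + v")
    case False
    then have "\<not> a < length x + n + n \<Longrightarrow> a - (length x + n + n) \<noteq> v" by arith
    then show ?thesis using False by (simp add: layout_def)
  qed (use assms in \<open>simp add: layout_def\<close>)
  then show "?M(length x + n + n + v := y) = layout n x T D (S(v := y))" by blast
qed

text \<open>Applied repeatedly, this rule runs a segment symbolically: its premises fetch one
  instruction, check its word bound and pass on to the next state.\<close>

lemma leads_instr: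
  assumes "p < length P" "P ! p = i" "0 < k" "within W i R"
    and "leads P W (k - 1) (exec i \<lparr>pc = p, reg = R, mem = M\<rparr>) Q"
  shows "leads P W k \<lparr>pc = p, reg = R, mem = M\<rparr> Q"
  by (rule leads_step) (use assms in auto)

section \<open>Symbolic execution of the program segments\<close>

locale machine =
  fixes l n W :: nat and x :: "nat list"
  assumes x: "x \<noteq> []" "x ! 0 = n"
    and W: "length x + 3 * n + 2 * l + 3 \<le> W"
begin

abbreviation state :: "nat \<Rightarrow> (nat \<Rightarrow> nat) \<Rightarrow> (nat \<Rightarrow> nat) \<Rightarrow> config" where
  "state p R M \<equiv> \<lparr>pc = p, reg = R, mem = M\<rparr>"

abbreviation steps :: "nat \<Rightarrow> config \<Rightarrow> (config \<Rightarrow> bool) \<Rightarrow> bool" where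
  "steps \<equiv> leads (program l) W"

definition base_regs :: "(nat \<Rightarrow> nat) \<Rightarrow> bool" where
  "base_regs R \<longleftrightarrow> R (Suc 0) = 1 \<and> R 2 = n \<and> R 3 = length x \<and> R 4 = length x + n \<and>
     R 5 = length x + n + n \<and> R 9 = 0"

text \<open>Like the following segment lemmas, this is in continuation style: the cost
  \<open>c\<close> and the postcondition \<open>Q\<close> of the remaining run are parameters, and
  only the registers read later are described.\<close>

lemma start:
  assumes cont: "\<And>R. base_regs R \<Longrightarrow> R 0 = length x \<Longrightarrow> R 6 = 1 \<Longrightarrow>
      steps c (state 6 R (layout n x (\<lambda>_. 0) (\<lambda>_. 0) (\<lambda>_. 0))) Q"
  shows "steps (c + 6) (initial_config x) Q"
proof -
  have m: "mem (initial_config x) = layout n x (\<lambda>_. 0) (\<lambda>_. 0) (\<lambda>_. 0)"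
    by (auto simp: initial_config_def layout_def)
  have i: "initial_config x = state 0 ((\<lambda>_. 0)(0 := length x)) (layout n x (\<lambda>_. 0) (\<lambda>_. 0) (\<lambda>_. 0))"
    using m by (simp add: initial_config_def)
  have xx: "0 < length x" using x by simp
  \<comment> \<open>Counting from 0, simplification leaves the program counter as a successor term,
    while the continuation expects a numeral.\<close>
  have six: "Suc (Suc (Suc (Suc (Suc (Suc 0))))) = 6" by simp
  show ?thesis unfolding i
    apply (rule leads_instr, simp add: length_program, simp add: program_def, simp, use W xx in simp, simp add: x xx)+
    apply (subst six)
    apply (rule cont)
      apply (simp_all add: base_regs_def)
    done
qed

lemma read_edge:
  assumes R: "base_regs R" "R 0 = length x" "R 6 = Suc (2 * k)"
    and k: "Suc (Suc (2 * k)) < length x" "x ! Suc (2 * k) = u" "x ! Suc (Suc (2 * k)) = v"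
    and uv: "u < n" "v < n" "u \<noteq> v"
    and b: "Suc (T u) \<le> W" "Suc (T v) \<le> W" "Suc (D u) \<le> W" "Suc (D v) \<le> W"
      "S u + v \<le> W" "S v + u \<le> W"
    and cont: "\<And>R. base_regs R \<Longrightarrow> R 0 = length x \<Longrightarrow> R 6 = Suc (2 * Suc k) \<Longrightarrow>
      steps c (state 6 R (layout n x (T(u := Suc (T u), v := Suc (T v)))
        (D(u := Suc (D u), v := Suc (D v))) (S(u := S u + v, v := S v + u)))) Q"
  shows "steps (c + 31) (state 6 R (layout n x T D S)) Q"
proof -
  have k': "Suc (2 * k) < length x" "\<not> length x \<le> Suc (2 * k)" using k by auto
  have vu: "v \<noteq> u" using uv by simp
  note R' = R[unfolded base_regs_def]
  show ?thesis
    apply (rule leads_instr, simp add: length_program, simp add: program_def, simp,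
        use W k k' uv b R' in simp, simp add: R' k k' uv vu)+
    apply (rule cont)
      apply (simp_all add: base_regs_def R')
    done
qed

lemma edges_read:
  assumes R: "base_regs R" "R 0 = length x" "length x \<le> R 6"
    and cont: "\<And>R. base_regs R \<Longrightarrow> R 6 = 0 \<Longrightarrow> R 8 = 2 * l - 2 \<Longrightarrow> R 10 = 0 \<Longrightarrow> steps c (state 40 R M) Q"
  shows "steps (c + 5) (state 6 R M) Q"
proof -
  note R' = R[unfolded base_regs_def]
  show ?thesis
    apply (rule leads_instr, simp add: length_program, simp add: program_def, simp,
        use W R' in simp, simp add: R')+
    apply (rule cont)
      apply (simp_all add: base_regs_def R')
    done
qed

text \<open>The cost 26 is that of the longest branch of the loop, the removal of a critical leaf.
  Shorter branches are padded to it, so that every iteration costs the same.\<close>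

lemma no_leaf:
  assumes R: "base_regs R" "R 6 = i" "R 8 = 2 * l - 2" "R 10 = v"
    and v: "v < n" "D v \<noteq> 1" and i: "Suc i < n"
    and cont: "\<And>R. base_regs R \<Longrightarrow> R 6 = Suc i \<Longrightarrow> R 8 = 2 * l - 2 \<Longrightarrow> R 10 = Suc i \<Longrightarrow>
      steps c (state 40 R (layout n x T D S)) Q"
  shows "steps (c + 26) (state 40 R (layout n x T D S)) Q"
proof -
  note R' = R[unfolded base_regs_def]
  have i': "\<not> n \<le> Suc i" using i by simp
  show ?thesis
  proof (cases "D v = 0")
    case True
    have "steps (c + 8) (state 40 R (layout n x T D S)) Q"
      apply (rule leads_instr, simp add: length_program, simp add: program_def, simp,
          use W R' v i in simp, simp add: R' v True i i')+
      apply (rule cont)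
        apply (simp_all add: base_regs_def R')
      done
    then show ?thesis by (rule leads_mono) simp
  next
    case False
    then have D: "D v \<noteq> 0" "\<not> D v \<le> Suc 0" using v by auto
    have "steps (c + 10) (state 40 R (layout n x T D S)) Q"
      apply (rule leads_instr, simp add: length_program, simp add: program_def, simp,
          use W R' v i in simp, simp add: R' v D i i')+
      apply (rule cont)
        apply (simp_all add: base_regs_def R')
      done
    then show ?thesis by (rule leads_mono) simp
  qed
qed

lemma no_leaf_last:
  assumes R: "base_regs R" "R 6 = i" "R 8 = 2 * l - 2" "R 10 = v"
    and v: "v < n" "D v \<noteq> 1" and i: "Suc i = n"
    and cont: "\<And>R. base_regs R \<Longrightarrow> steps c (state 72 R (layout n x T D S)) Q"
  shows "steps (c + 26) (state 40 R (layout n x T D S)) Q"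
proof -
  note R' = R[unfolded base_regs_def]
  show ?thesis
  proof (cases "D v = 0")
    case True
    have "steps (c + 7) (state 40 R (layout n x T D S)) Q"
      apply (rule leads_instr, simp add: length_program, simp add: program_def, simp,
          use W R' v i in simp, simp add: R' v True i)+
      apply (rule cont)
      apply (simp_all add: base_regs_def R')
      done
    then show ?thesis by (rule leads_mono) simp
  next
    case False
    then have D: "D v \<noteq> 0" "\<not> D v \<le> Suc 0" using v by auto
    have "steps (c + 9) (state 40 R (layout n x T D S)) Q"
      apply (rule leads_instr, simp add: length_program, simp add: program_def, simp,
          use W R' v i in simp, simp add: R' v D i)+
      apply (rule cont)
      apply (simp_all add: base_regs_def R')
      done
    then show ?thesis by (rule leads_mono) simp
  qed
qed

text \<open>Truncated subtraction reduces the comparison of 2l - 2 with \<open>T v\<close> to a zero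
  test. As \<open>p\<close> differs from \<open>v\<close>, the updates at the two vertices do not
  interfere.\<close>

lemma peel_leaf:
  assumes R: "base_regs R" "R 6 = i" "R 8 = 2 * l - 2" "R 10 = v"
    and v: "v < n" "D v = 1" and p: "S v = p" "p < n" "p \<noteq> v" and b: "Suc (T p) \<le> W"
    and cont: "\<And>R. base_regs R \<Longrightarrow> R 6 = i \<Longrightarrow> R 8 = 2 * l - 2 \<Longrightarrow> R 10 = p \<Longrightarrow>
      steps c (state 40 R (layout n x (if 2 * l - 2 \<le> T v then T(p := Suc (T p)) else T)
        (D(v := 0, p := D p - 1)) (S(p := S p - v)))) Q"
  shows "steps (c + 26) (state 40 R (layout n x T D S)) Q"
proof -
  note R' = R[unfolded base_regs_def]
  have vp: "v \<noteq> p" using p by simp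
  show ?thesis
  proof (cases "2 * l - 2 \<le> T v")
    case True
    have t: "2 * l \<le> Suc (Suc (T v))" using True by simp
    show ?thesis
      apply (rule leads_instr, simp add: length_program, simp add: program_def, simp,
          use W R' v p b in simp, simp add: R' v p vp True t)+
      apply (subst One_nat_def[symmetric])
      apply (rule cont[unfolded if_P[OF True]])
         apply (simp_all add: base_regs_def R')
      done
  next
    case False
    have t: "\<not> 2 * l \<le> Suc (Suc (T v))" "T v < 2 * l - 2" using False by simp_all
    have "steps (c + 23) (state 40 R (layout n x T D S)) Q"
      apply (rule leads_instr, simp add: length_program, simp add: program_def, simp,
          use W R' v p b in simp, simp add: R' v p vp t)+
      apply (subst One_nat_def[symmetric])
      apply (rule cont[unfolded if_not_P[OF False]])
         apply (simp_all add: base_regs_def R')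
      done
    then show ?thesis by (rule leads_mono) simp
  qed
qed

lemma scan_start:
  assumes R: "base_regs R"
    and cont: "\<And>R. base_regs R \<Longrightarrow> R 6 = 0 \<Longrightarrow> R 8 = 2 * l - 1 \<Longrightarrow> R 0 = 0 \<Longrightarrow>
      steps c (state 75 R M) Q"
  shows "steps (c + 3) (state 72 R M) Q"
proof -
  note R' = R[unfolded base_regs_def]
  show ?thesis
    apply (rule leads_instr, simp add: length_program, simp add: program_def, simp,
        use W R' in simp, simp add: R')+
    apply (rule cont)
       apply (simp_all add: base_regs_def R')
    done
qed

lemma scan_vertex:
  assumes R: "base_regs R" "R 6 = i" "R 8 = 2 * l - 1" and i: "i < n"
    and cont: "\<And>R'. base_regs R' \<Longrightarrow> R' 6 = Suc i \<Longrightarrow> R' 8 = 2 * l - 1 \<Longrightarrow>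
      R' 0 = (if 2 * l - 1 \<le> T i then 1 else R 0) \<Longrightarrow> steps c (state 75 R' (layout n x T D S)) Q"
  shows "steps (c + 9) (state 75 R (layout n x T D S)) Q"
proof -
  note R' = R[unfolded base_regs_def]
  have i': "\<not> n \<le> i" using i by simp
  show ?thesis
  proof (cases "2 * l - 1 \<le> T i")
    case True
    have t: "2 * l \<le> Suc (T i)" using True by simp
    show ?thesis
      apply (rule leads_instr, simp add: length_program, simp add: program_def, simp,
          use W R' i in simp, simp add: R' i i' t)+
      apply (rule cont[unfolded if_P[OF True]])
         apply (simp_all add: base_regs_def R')
      done
  next
    case False
    have t: "\<not> 2 * l \<le> Suc (T i)" "T i < 2 * l - 1" using False by simp_all
    have "steps (c + 8) (state 75 R (layout n x T D S)) Q"
      apply (rule leads_instr, simp add: length_program, simp add: program_def, simp,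
          use W R' i in simp, simp add: R' i i' t)+
      apply (rule cont[unfolded if_not_P[OF False]])
         apply (simp_all add: base_regs_def R')
      done
    then show ?thesis by (rule leads_mono) simp
  qed
qed

lemma scan_end:
  assumes R: "base_regs R" "R 6 = n"
    and cont: "\<And>R'. R' 0 = R 0 \<Longrightarrow> steps c (state 85 R' M) Q"
  shows "steps (c + 2) (state 75 R M) Q"
proof -
  note R' = R[unfolded base_regs_def]
  show ?thesis
    apply (rule leads_instr, simp add: length_program, simp add: program_def, simp,
        use W R' in simp, simp add: R')+
    apply (rule cont)
    apply simp
    done
qed

end

section \<open>The loops\<close>

lemma length_pairs: "length (concat (map (\<lambda>(u, v). [u, v]) es)) = 2 * length es"
  by (induction es) auto

lemma nth_pairs:
  assumes "k < length es"
  shows "concat (map (\<lambda>(u, v). [u, v]) es) ! (2 * k) = fst (es ! k)"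
    and "concat (map (\<lambda>(u, v). [u, v]) es) ! Suc (2 * k) = snd (es ! k)"
proof -
  have "concat (map (\<lambda>(u, v). [u, v]) es) ! (2 * k) = fst (es ! k) \<and>
    concat (map (\<lambda>(u, v). [u, v]) es) ! Suc (2 * k) = snd (es ! k)"
    using assms
  proof (induction es arbitrary: k)
    case (Cons e es) then show ?case by (cases k; cases e) auto
  qed simp
  then show "concat (map (\<lambda>(u, v). [u, v]) es) ! (2 * k) = fst (es ! k)"
    and "concat (map (\<lambda>(u, v). [u, v]) es) ! Suc (2 * k) = snd (es ! k)" by auto
qed

lemma neighbours_insert:
  assumes "u \<noteq> v"
  shows "neighbours (insert {u, v} A) w =
    (if w = u then insert v (neighbours A u) else if w = v then insert u (neighbours A v) else neighbours A w)"
  using assms by (auto simp: neighbours_def doubleton_eq_iff)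

abbreviation degree :: "'a set set \<Rightarrow> 'a \<Rightarrow> nat" where
  "degree A \<equiv> \<lambda>v. card (neighbours A v)"

abbreviation neighbour_sum :: "nat set set \<Rightarrow> nat \<Rightarrow> nat" where
  "neighbour_sum A \<equiv> \<lambda>v. \<Sum>(neighbours A v)"

lemma
  assumes "simple_graph {..<n} A"
  shows degree_le: "degree A v \<le> n" and neighbour_sum_le: "neighbour_sum A v \<le> n * n"
proof -
  have sub: "neighbours A v \<subseteq> {..<n}" using neighbours_subset[OF assms, of v] by blast
  then show d: "degree A v \<le> n" using card_mono[OF _ sub] by simp
  have "neighbour_sum A v \<le> of_nat (degree A v) * n"
    by (rule sum_bounded_above) (use sub in auto)
  also have "\<dots> \<le> n * n" using d by simp
  finally show "neighbour_sum A v \<le> n * n" .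
qed

lemma
  assumes A: "simple_graph {..<n} A" and uv: "u \<noteq> v" "{u, v} \<notin> A"
  shows degree_insert: "degree (insert {u, v} A) =
      (degree A)(u := Suc (degree A u), v := Suc (degree A v))"
    and neighbour_sum_insert: "neighbour_sum (insert {u, v} A) =
      (neighbour_sum A)(u := neighbour_sum A u + v, v := neighbour_sum A v + u)"
proof -
  have fin: "finite (neighbours A w)" for w
    using neighbours_subset[OF A, of w] finite_subset by blast
  have "v \<notin> neighbours A u" "u \<notin> neighbours A v"
    using uv by (auto simp: neighbours_def insert_commute)
  with fin show "degree (insert {u, v} A) = (degree A)(u := Suc (degree A u), v := Suc (degree A v))"
    "neighbour_sum (insert {u, v} A) =
      (neighbour_sum A)(u := neighbour_sum A u + v, v := neighbour_sum A v + u)"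
    using uv(1) by (auto simp: neighbours_insert fun_eq_iff)
qed

context machine
begin

text \<open>After \<open>k\<close> edges the tables describe the graph \<open>A k\<close>;
  \<open>T\<close> starts out as the degree. Distinctness makes each edge new, so the counters are
  true degrees. The read position is odd because cell 0 holds \<open>n\<close>.\<close>

lemma read_edges:
  fixes es :: "(nat \<times> nat) list"
  defines "A \<equiv> \<lambda>k. set (take k (map (\<lambda>(u, v). {u, v}) es))"
  assumes es: "x = n # concat (map (\<lambda>(u, v). [u, v]) es)" "distinct (map (\<lambda>(u, v). {u, v}) es)"
    and simple: "simple_graph {..<n} (set (map (\<lambda>(u, v). {u, v}) es))"
    and W2: "n * n \<le> W"
    and R: "base_regs R" "R 0 = length x" "R 6 = Suc (2 * k)" and k: "k \<le> length es"
    and cont: "\<And>R. base_regs R \<Longrightarrow> R 0 = length x \<Longrightarrow> R 6 = length x \<Longrightarrow>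
      steps c (state 6 R (layout n x (degree (A (length es))) (degree (A (length es)))
        (neighbour_sum (A (length es))))) Q"
  shows "steps (c + 31 * (length es - k))
    (state 6 R (layout n x (degree (A k)) (degree (A k)) (neighbour_sum (A k)))) Q"
  using R k
proof (induction "length es - k" arbitrary: k R)
  case 0
  then have "k = length es" by simp
  then show ?case using 0 cont[of R] es(1) length_pairs[of es] by simp
next
  case (Suc d)
  have k: "k < length es" using Suc by simp
  define u v where "u = fst (es ! k)" and "v = snd (es ! k)"
  have lx: "length x = Suc (2 * length es)" using es(1) length_pairs[of es] by simp
  have AS: "A (Suc k) = insert {u, v} (A k)"
    using k unfolding A_def u_def v_def by (simp add: take_Suc_conv_app_nth split_beta)
  have "A (Suc k) \<subseteq> set (map (\<lambda>(u, v). {u, v}) es)"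
    unfolding A_def by (rule set_take_subset)
  then have s': "simple_graph {..<n} (A (Suc k))" using simple_graph_subset[OF simple] by blast
  then have s: "simple_graph {..<n} (A k)" by (rule simple_graph_subset) (use AS in blast)
  have "\<exists>a\<in>{..<n}. \<exists>b\<in>{..<n}. a \<noteq> b \<and> {u, v} = {a, b}"
    using s' AS unfolding simple_graph_def by blast
  then have uv: "u < n" "v < n" "u \<noteq> v" by (auto simp: doubleton_eq_iff)
  have new: "{u, v} \<notin> A k"
  proof
    assume "{u, v} \<in> A k"
    then obtain j where j: "j < k" "(map (\<lambda>(u, v). {u, v}) es) ! j = {u, v}"
      using k unfolding A_def by (auto simp: in_set_conv_nth)
    have "(map (\<lambda>(u, v). {u, v}) es) ! k = {u, v}" using k by (simp add: u_def v_def split_beta)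
    then show False using es(2) j k nth_eq_iff_index_eq[of "map (\<lambda>(u, v). {u, v}) es" j k] by simp
  qed
  note di = degree_insert[OF s uv(3) new, folded AS] and si = neighbour_sum_insert[OF s uv(3) new, folded AS]
  have nW: "n \<le> W" using W by simp
  \<comment> \<open>The results of the additions are degrees and neighbour sums of
    \<open>A (Suc k)\<close>, and are bounded as such.\<close>
  have dle: "degree (A (Suc k)) w \<le> W" for w using degree_le[OF s', of w] nW by simp
  have sle: "neighbour_sum (A (Suc k)) w \<le> W" for w using neighbour_sum_le[OF s', of w] W2 by simp
  have "steps ((c + 31 * (length es - Suc k)) + 31)
    (state 6 R (layout n x (degree (A k)) (degree (A k)) (neighbour_sum (A k)))) Q"
  proof (rule read_edge[where k = k and u = u and v = v])
    show "x ! Suc (2 * k) = u" "x ! Suc (Suc (2 * k)) = v"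
      using nth_pairs[OF k] es(1) by (simp_all add: u_def v_def)
    show "Suc (degree (A k) u) \<le> W" "Suc (degree (A k) v) \<le> W"
      using dle[of u] dle[of v] uv(3) fun_cong[OF di, of u] fun_cong[OF di, of v] by simp_all
    then show "Suc (degree (A k) u) \<le> W" "Suc (degree (A k) v) \<le> W" .
    show "neighbour_sum (A k) u + v \<le> W" "neighbour_sum (A k) v + u \<le> W"
      using sle[of u] sle[of v] uv(3) fun_cong[OF si, of u] fun_cong[OF si, of v] by simp_all
  next
    fix R assume "base_regs R" "R 0 = length x" "R 6 = Suc (2 * Suc k)"
    then show "steps (c + 31 * (length es - Suc k)) (state 6 R (layout n x
        ((degree (A k))(u := Suc (degree (A k) u), v := Suc (degree (A k) v)))
        ((degree (A k))(u := Suc (degree (A k) u), v := Suc (degree (A k) v)))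
        ((neighbour_sum (A k))(u := neighbour_sum (A k) u + v, v := neighbour_sum (A k) v + u)))) Q"
      using Suc.hyps(1)[of "Suc k" R] Suc.hyps(2) k unfolding di si by simp
  qed (use Suc.prems uv lx k in auto)
  moreover have "c + 31 * (length es - Suc k) + 31 = c + 31 * (length es - k)" using k by simp
  ultimately show ?case by simp
qed

text \<open>The current vertex \<open>v\<close> is the only possible leaf up to the scan index
  \<open>i\<close>. Peeling it can create a leaf only at its neighbour, which becomes current. Each
  iteration either removes an edge or advances \<open>i\<close>, so n - i + |F| drops by one and the
  total time is linear.\<close>

lemma peel_leaves:
  assumes "peeling l n E N par rank F T D S"
    and "base_regs R" "R 6 = i" "R 8 = 2 * l - 2" "R 10 = v" and "i < n" "v < n"
    and "\<And>u. u \<le> i \<Longrightarrow> u \<noteq> v \<Longrightarrow> D u \<noteq> 1"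
    and cont: "\<And>N par rank F T D S R. peeling l n E N par rank F T D S \<Longrightarrow>
      (\<And>u. u < n \<Longrightarrow> D u \<noteq> 1) \<Longrightarrow> base_regs R \<Longrightarrow> steps c (state 72 R (layout n x T D S)) Q"
  shows "steps (c + 26 * (n - i + card F)) (state 40 R (layout n x T D S)) Q"
  using assms(1-8)
proof (induction "n - i + card F" arbitrary: N par rank F T D S R i v rule: less_induct)
  case less
  interpret peeling l n E N par rank F T D S by (rule less.prems(1))
  note R = less.prems(2-5) and i = less.prems(6) and v = less.prems(7) and old = less.prems(8)
  consider "D v = 1" | "D v \<noteq> 1" "Suc i < n" | "D v \<noteq> 1" "Suc i = n" using i by linarith
  then show ?case
  proof cases
    case 1
    define p where "p = S v"
    note lf = leaf[OF v 1, folded p_def]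
    let ?F = "F - {{v, p}}"
    have card: "card F = Suc (card ?F)" by (rule card.remove[OF finF lf(4)])
    have "Suc (T p) \<le> W" using T_le[of p] lf W by simp
    have "steps (c + 26 * (n - i + card ?F) + 26) (state 40 R (layout n x T D S)) Q"
    proof (rule peel_leaf[where v = v and p = p and i = i])
      show "p < n" "p \<noteq> v" "Suc (T p) \<le> W" by fact+
    next
      fix R assume R: "base_regs R" "R 6 = i" "R 8 = 2 * l - 2" "R 10 = p"
      show "steps (c + 26 * (n - i + card ?F)) (state 40 R (layout n x
          (if 2 * l - 2 \<le> T v then T(p := Suc (T p)) else T) (D(v := 0, p := D p - 1)) (S(p := S p - v)))) Q"
        by (rule less.hyps[OF _ peel[OF v 1, folded p_def] R i]) (use lf card old in auto)
    qed (use R v 1 p_def in auto)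
    then show ?thesis unfolding card by (simp add: algebra_simps)
  next
    case 2
    have "steps (c + 26 * (n - Suc i + card F) + 26) (state 40 R (layout n x T D S)) Q"
    proof (rule no_leaf[where D = D, OF R v 2])
      fix R assume R: "base_regs R" "R 6 = Suc i" "R 8 = 2 * l - 2" "R 10 = Suc i"
      show "steps (c + 26 * (n - Suc i + card F)) (state 40 R (layout n x T D S)) Q"
        by (rule less.hyps[OF _ less.prems(1) R]) (use 2 i old in \<open>auto simp: le_Suc_eq\<close>)
    qed
    moreover have "n - i = Suc (n - Suc i)" using i by simp
    ultimately show ?thesis by (simp add: algebra_simps)
  next
    case 3
    have "D u \<noteq> 1" if "u < n" for u using that 3 old[of u] by (cases "u = v") auto
    then have "steps (c + 26) (state 40 R (layout n x T D S)) Q"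
      by (intro no_leaf_last[where D = D, OF R v 3] cont[OF less.prems(1)])
    then show ?thesis by (rule leads_mono) (use i in simp)
  qed
qed

lemma scan:
  assumes "base_regs R" "R 6 = i" "R 8 = 2 * l - 1" "R 0 = (if \<exists>v<i. 2 * l - 1 \<le> T v then 1 else 0)" "i \<le> n"
  shows "steps (2 + 9 * (n - i)) (state 75 R (layout n x T D S))
    (\<lambda>s. halted (program l) s \<and> reg s 0 = (if \<exists>v<n. 2 * l - 1 \<le> T v then 1 else 0))"
  using assms
proof (induction "n - i" arbitrary: R i)
  case 0
  then have i: "i = n" by simp
  have "steps (0 + 2) (state 75 R (layout n x T D S))
    (\<lambda>s. halted (program l) s \<and> reg s 0 = (if \<exists>v<n. 2 * l - 1 \<le> T v then 1 else 0))"
  proof (rule scan_end[OF 0(2) 0(3)[unfolded i]])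
    fix R' :: "nat \<Rightarrow> nat" assume "R' 0 = R 0"
    then show "steps 0 (state 85 R' (layout n x T D S))
      (\<lambda>s. halted (program l) s \<and> reg s 0 = (if \<exists>v<n. 2 * l - 1 \<le> T v then 1 else 0))"
      by (intro leads_refl) (use 0(5) i in \<open>simp add: halted_def length_program\<close>)
  qed
  moreover have "2 + 9 * (n - i) = 0 + 2" using i by simp
  ultimately show ?case by (simp only:)
next
  case (Suc d)
  then have i: "i < n" "n - i = Suc (n - Suc i)" by simp_all
  have "steps (2 + 9 * (n - Suc i) + 9) (state 75 R (layout n x T D S))
    (\<lambda>s. halted (program l) s \<and> reg s 0 = (if \<exists>v<n. 2 * l - 1 \<le> T v then 1 else 0))"
  proof (rule scan_vertex[OF Suc.prems(1-3) i(1)])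
    fix R' assume R': "base_regs R'" "R' 6 = Suc i" "R' 8 = 2 * l - 1"
      "R' 0 = (if 2 * l - 1 \<le> T i then 1 else R 0)"
    show "steps (2 + 9 * (n - Suc i)) (state 75 R' (layout n x T D S))
      (\<lambda>s. halted (program l) s \<and> reg s 0 = (if \<exists>v<n. 2 * l - 1 \<le> T v then 1 else 0))"
      by (rule Suc.hyps(1)[OF _ R'(1-3)])
        (use Suc.hyps(2) Suc.prems(4) R'(4) i in \<open>auto simp: less_Suc_eq simp del: One_nat_def\<close>)
  qed
  then show ?case using i by (simp add: algebra_simps)
qed

lemma program_answers:
  assumes l: "l \<ge> 1" and tree: "finite_tree {..<n} E"
    and es: "x = n # concat (map (\<lambda>(u, v). [u, v]) es)" "distinct (map (\<lambda>(u, v). {u, v}) es)"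
      "E = set (map (\<lambda>(u, v). {u, v}) es)"
    and W2: "n * n \<le> W"
  shows "answers_within (program l) x (maker_wins_star_game l {..<n} E) (108 * n) W"
proof (rule answers_withinI)
  let ?Q = "\<lambda>s. halted (program l) s \<and> reg s 0 = (if maker_wins_star_game l {..<n} E then 1 else 0)"
  let ?m = "length es"
  have simple: "simple_graph {..<n} E" and acyc: "\<nexists>p. is_cycle E p" and n: "0 < n"
    using tree unfolding finite_tree_def connected_graph_def by auto
  have "card E = ?m" using distinct_card[OF es(2)] es(3) by simp
  then have m: "?m < n" "card E = ?m"
    using card_edges_less_card_vertices[of "{..<n}" E] simple acyc n by auto
  have "u < n \<and> v < n" if "(u, v) \<in> set es" for u v
  proof -
    have "{u, v} \<in> E" using that es(3) by force
    then show ?thesis using simple unfolding simple_graph_def by (auto simp: doubleton_eq_iff)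
  qed
  then have "y \<le> n" if "y \<in> set x" for y using that es(1) by fastforce
  then have xW: "x ! i \<le> W" if "i < length x" for i
    using nth_mem[OF that] W by fastforce
  show "bounded W (initial_config x)"
    using xW W by (auto simp: bounded_def initial_config_def)
  have scanning: "steps (2 + 9 * n + 3) (state 72 R (layout n x T D S)) ?Q"
    if P: "peeling l n E N par rank F T D S" "\<And>u. u < n \<Longrightarrow> D u \<noteq> 1" "base_regs R" for N par rank F T D S R
  proof (rule scan_start[OF P(3)])
    have w: "maker_wins_star_game l {..<n} E \<longleftrightarrow> (\<exists>v<n. 2 * l - 1 \<le> T v)"
      using peeling.maker_wins_iff[OF P(1) l acyc] P(2) by blast
    fix R assume "base_regs R" "R 6 = 0" "R 8 = 2 * l - 1" "R 0 = 0"
    then show "steps (2 + 9 * n) (state 75 R (layout n x T D S)) ?Q"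
      unfolding w
      using scan[of R 0 T D S] by simp
  qed
  let ?A = "\<lambda>k. set (take k (map (\<lambda>(u, v). {u, v}) es))"
  have A: "?A ?m = E" "?A 0 = {}" using es(3) by auto
  \<comment> \<open>The summands list the phases backwards: final scan, at most n + |E| peeling
    iterations, preparation, reading of the edges, initialization.\<close>
  have "steps (((2 + 9 * n + 3) + 26 * (n - 0 + card E) + 5) + 31 * (?m - 0) + 6) (initial_config x) ?Q"
  proof (rule start)
    fix R assume R: "base_regs R" "R 0 = length x" "R 6 = 1"
    have "steps (((2 + 9 * n + 3) + 26 * (n - 0 + card E) + 5) + 31 * (?m - 0))
      (state 6 R (layout n x (degree (?A 0)) (degree (?A 0)) (neighbour_sum (?A 0)))) ?Q"
    proof (rule read_edges[OF es(1,2) simple[unfolded es(3)] W2 R(1,2)])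
      fix R assume R: "base_regs R" "R 0 = length x" "R 6 = length x"
      show "steps ((2 + 9 * n + 3) + 26 * (n - 0 + card E) + 5)
        (state 6 R (layout n x (degree (?A ?m)) (degree (?A ?m)) (neighbour_sum (?A ?m)))) ?Q"
        unfolding A
      proof (rule edges_read[OF R(1,2)])
        fix R assume R: "base_regs R" "R 6 = 0" "R 8 = 2 * l - 2" "R 10 = 0"
        show "steps ((2 + 9 * n + 3) + 26 * (n - 0 + card E))
          (state 40 R (layout n x (degree E) (degree E) (neighbour_sum E))) ?Q"
          by (rule peel_leaves[OF peeling_start[OF simple] R n n _ scanning]) auto
      qed (use R in simp)
    qed (use R in auto)
    then show "steps (((2 + 9 * n + 3) + 26 * (n - 0 + card E) + 5) + 31 * (?m - 0))
      (state 6 R (layout n x (\<lambda>_. 0) (\<lambda>_. 0) (\<lambda>_. 0))) ?Q"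
      by (simp add: neighbours_def)
  qed
  \<comment> \<open>The sum is 16 + 35n + 57m with m < n, hence at most 108n.\<close>
  then show "steps (108 * n) (initial_config x) ?Q"
    by (rule leads_mono) (use m in simp)
qed

end

section \<open>The linear time bound for trees\<close>

theorem theorem12:
  fixes l :: nat
  assumes "l \<ge> 1"
  shows "\<exists>P C c. \<forall>V E x. finite_tree V E \<and> encodes_graph x V E \<longrightarrow>
           answers_within P x (maker_wins_star_game l V E) (C * card V) ((card V + 1) ^ c)"
proof (intro exI allI impI)
  fix V E x
  assume "finite_tree V E \<and> encodes_graph x V E"
  then obtain n es where tree: "finite_tree {..<n} E"
    and es: "x = n # concat (map (\<lambda>(u, v). [u, v]) es)" "distinct (map (\<lambda>(u, v). {u, v}) es)"
      "E = set (map (\<lambda>(u, v). {u, v}) es)" and V: "V = {..<n}"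
    unfolding encodes_graph_def by blast
  \<comment> \<open>Neighbour sums reach n^2, and a constant multiple of 2l must fit even for n = 1.
    As (n + 1)^k \<ge> 2^k > k for k = 2l + 20, the exponent k + 2 yields k (n + 1)^2, which covers
    both.\<close>
  let ?W = "(n + 1) ^ (2 * l + 20 + 2)"
  have "simple_graph {..<n} E" "\<nexists>p. is_cycle E p" "0 < n"
    using tree unfolding finite_tree_def connected_graph_def by auto
  then have "card E < n" using card_edges_less_card_vertices[of "{..<n}" E] by auto
  then have m: "length es < n" using distinct_card[OF es(2)] es(3) by simp
  have "2 * l + 20 \<le> 2 ^ (2 * l + 20)" by (rule less_imp_le[OF less_exp])
  also have "\<dots> \<le> (n + 1) ^ (2 * l + 20)" using \<open>0 < n\<close> by (intro power_mono) auto
  finally have "(2 * l + 20) * (n + 1)^2 \<le> (n + 1) ^ (2 * l + 20) * (n + 1)^2" by (rule mult_le_mono1)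
  also have "\<dots> = ?W" by (simp only: power_add)
  finally have W: "(2 * l + 20) * (n + 1)^2 \<le> ?W" .
  have sq: "n * n + 2 * n + 1 = (n + 1)^2" by (simp add: power2_eq_square)
  have W': "2 * l + 20 * (n * n + 2 * n + 1) \<le> ?W"
  proof -
    have "2 * l * 1 \<le> 2 * l * (n + 1)^2" by (rule mult_le_mono2) simp
    then show ?thesis using W unfolding sq add_mult_distrib by linarith
  qed
  interpret machine l n ?W x
    by unfold_locales (use es(1) length_pairs[of es] m W' in auto)
  show "answers_within (program l) x (maker_wins_star_game l V E) (108 * card V) ((card V + 1) ^ (2 * l + 20 + 2))"
    unfolding V card_lessThan by (rule program_answers[OF assms tree es]) (use W' in simp)
qed

end
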